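(* Let $F:\mathbb{R}^n\rightrightarrows\mathbb{R}^n$ satisfy assumptions (F) and (H), let $\mathcal{K}\subset\mathbb{R}^n$ be closed, let $\mathcal{T}$ be the associated minimum time function, and let $x_0\in\mathcal{R}\setminus\mathcal{K}$. Let $\bar x:[0,\mathcal{T}(x_0)]\to\mathbb{R}^n$ be an optimal trajectory for $x_0$ and let $\bar p:[0,\mathcal{T}(x_0)]\to\mathbb{R}^n$ be an absolutely continuous arc such that $(\bar x,\bar p)$ is a solution of the system $$\dot x(s)=\nabla_pH(x(s),p(s)),\qquad -\dot p(s)\in\partial_xH(x(s),p(s)),\qquad\text{a.e. } s\in[0,\mathcal{T}(x_0)],$$ satisfying $\bar x(0)=x_0$ and $-\bar p(0)\in\partial^P\mathcal{T}(x_0)$. Then, for all $t\in[0,\mathcal{T}(x_0)]$, $$-\bar p(t)\in\partial^P\mathcal{T}(\bar x(t))\quad\text{and}\quad h(\bar x(t),-\bar p(t))=-1.$$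
   Context: Assumption (F) on a multifunction $F:\mathbb{R}^n\rightrightarrows\mathbb{R}^n$: (F1) $F(x)$ is nonempty, convex and compact for each $x\in\mathbb{R}^n$; (F2) for each compact $Q\subset\mathbb{R}^n$ there is $L>0$ with $F(x)\subset F(y)+L|y-x|\bar{\mathbb{B}}$ for all $x,y\in Q$, where $\bar{\mathbb{B}}$ is the closed unit ball; (F3) there is $\gamma>0$ with $\max\{|v|:v\in F(x)\}\le\gamma(1+|x|)$ for all $x\in\mathbb{R}^n$. Hamiltonians: $H(x,p)=\max_{v\in F(x)}\langle v,p\rangle$ and $h(x,\zeta)=\min_{v\in F(x)}\langle v,\zeta\rangle$. $\nabla_pH$ is the partial gradient in $p$; $\partial_xH(x,p)$ is Clarke's generalized gradient of $x\mapsto H(x,p)$, i.e. for a locally Lipschitz $f$, $\partial f(x)=\mathrm{co}\{v:\exists y_i\to x,\ f \text{ differentiable at } y_i,\ \nabla f(y_i)\to v\}$. Assumption (H): for every $r>0$, (H1) there exists $c\ge0$ so that for every $p\in\mathbb{S}^{n-1}$ (the unit sphere) the mapping $x\mapsto H(x,p)$ is semiconvex with semiconvexity constant $c$; (H2) $\nabla_pH(x,p)$ exists and is Lipschitz in $x$ on $B(0,r)$, uniformly for $p\in\mathbb{R}^n\setminus\{0\}$. Here a function $g$ on an open set $\Omega$ is semiconvex with constant $c$ if it is continuous and $g(x+k)+g(x-k)-2g(x)\ge-c|k|^2$ whenever $[x-k,x+k]\subset\Omega$. A trajectory of $F$ starting at $x$ is an absolutely continuous $x(\cdot)$ on $[0,T]$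 with $\dot x(t)\in F(x(t))$ for a.e. $t$ and $x(0)=x$. The minimum time function $\mathcal{T}:\mathbb{R}^n\to[0,+\infty]$ associated with the closed target $\mathcal{K}$ is $\mathcal{T}(x)=0$ if $x\in\mathcal{K}$, and otherwise $\mathcal{T}(x)=\inf\{T>0:\text{there is a trajectory } x(\cdot) \text{ of } F \text{ with } x(0)=x,\ x(T)\in\mathcal{K}\}$, with $\inf\emptyset=+\infty$. The controllable set is $\mathcal{R}=\{x:\mathcal{T}(x)<+\infty\}$. An optimal trajectory for $x_0\in\mathcal{R}$ is a trajectory $\bar x$ of $F$ on $[0,\mathcal{T}(x_0)]$ with $\bar x(0)=x_0$ and $\bar x(\mathcal{T}(x_0))\in\mathcal{K}$. For a closed set $E$ and $x\in E$, the proximal normal cone $N^P_E(x)$ is the set of $v$ for which there is $\sigma\ge0$ with $\langle v,y-x\rangle\le\sigma|y-x|^2$ for all $y\in E$. The epigraph is $\mathrm{epi}(\mathcal{T})=\{(x,\beta)\in\mathbb{R}^n\times\mathbb{R}:\mathcal{T}(x)<+\infty,\ \beta\ge\mathcal{T}(x)\}$. The proximal subdifferential is $\partial^P\mathcal{T}(x)=\{v\in\mathbb{R}^n:(v,-1)\in N^P_{\mathrm{epi}(\mathcal{T})}(x,\mathcal{T}(x))\}$. *)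

theory Defs
  imports "HOL-Analysis.Analysis"
begin

text \<open>A set-valued map is a function \<open>F :: 'a \<Rightarrow> 'a set\<close>. Arcs are total functions on the reals, of which
  only the restriction to \<open>{0..T}\<close> matters.\<close>

definition assumption_F :: "('a::euclidean_space \<Rightarrow> 'a set) \<Rightarrow> bool" where
  "assumption_F F \<longleftrightarrow>
     (\<forall>x. F x \<noteq> {} \<and> convex (F x) \<and> compact (F x)) \<and>
     (\<forall>Q. compact Q \<longrightarrow> (\<exists>L>0. \<forall>x\<in>Q. \<forall>y\<in>Q.
        F x \<subseteq> {w + (L * norm (y - x)) *\<^sub>R b | w b. w \<in> F y \<and> b \<in> cball 0 1})) \<and>
     (\<exists>\<gamma>>0. \<forall>x. \<forall>v\<in>F x. norm v \<le> \<gamma> * (1 + norm x))"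

text \<open>Under \<open>assumption_F\<close> the values of \<open>F\<close> are nonempty and compact, so the supremum and the infimum
  below are attained: they are the maximum and the minimum of the Hamiltonians.\<close>

definition Ham :: "('a::euclidean_space \<Rightarrow> 'a set) \<Rightarrow> 'a \<Rightarrow> 'a \<Rightarrow> real" where
  "Ham F x p = (SUP v\<in>F x. v \<bullet> p)"

definition min_Ham :: "('a::euclidean_space \<Rightarrow> 'a set) \<Rightarrow> 'a \<Rightarrow> 'a \<Rightarrow> real" where
  "min_Ham F x \<zeta> = (INF v\<in>F x. v \<bullet> \<zeta>)"

definition semiconvex_on :: "real \<Rightarrow> 'a::euclidean_space set \<Rightarrow> ('a \<Rightarrow> real) \<Rightarrow> bool" where
  "semiconvex_on c \<Omega> g \<longleftrightarrow> continuous_on \<Omega> g \<and>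
     (\<forall>x k. closed_segment (x - k) (x + k) \<subseteq> \<Omega> \<longrightarrow>
        g (x + k) + g (x - k) - 2 * g x \<ge> - c * (norm k)\<^sup>2)"

text \<open>Both the semiconvexity constant and the Lipschitz constant may depend on the radius \<open>r\<close> (semiconvexity
  is required on \<open>ball 0 r\<close>), but not on \<open>p\<close>. The function \<open>G\<close> is the partial gradient of \<open>Ham F\<close> in \<open>p\<close>.\<close>

definition assumption_H :: "('a::euclidean_space \<Rightarrow> 'a set) \<Rightarrow> bool" where
  "assumption_H F \<longleftrightarrow> (\<forall>r>0.
     (\<exists>c\<ge>0. \<forall>p\<in>sphere 0 1. semiconvex_on c (ball 0 r) (\<lambda>x. Ham F x p)) \<and>
     (\<exists>L G. \<forall>p. p \<noteq> 0 \<longrightarrow>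
        (\<forall>x\<in>ball 0 r. GDERIV (Ham F x) p :> G x p) \<and>
        L-lipschitz_on (ball 0 r) (\<lambda>x. G x p)))"

definition clarke_gradient :: "('a::euclidean_space \<Rightarrow> real) \<Rightarrow> 'a \<Rightarrow> 'a set" where
  "clarke_gradient f x = convex hull
     {v. \<exists>y g. y \<longlonglongrightarrow> x \<and> (\<forall>i::nat. GDERIV f (y i) :> g i) \<and> g \<longlonglongrightarrow> v}"

text \<open>The usual \<open>\<epsilon>\<close>-\<open>\<delta>\<close> definition: a division is a finite family of nonempty compact intervals
  \<open>[Inf k, Sup k]\<close> with pairwise disjoint interiors.\<close>

definition abs_continuous_on :: "real set \<Rightarrow> (real \<Rightarrow> 'a::real_normed_vector) \<Rightarrow> bool" where
  "abs_continuous_on S f \<longleftrightarrow> (\<forall>\<epsilon>>0. \<exists>\<delta>>0. \<forall>\<D>.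
     \<D> division_of \<Union>\<D> \<and> \<Union>\<D> \<subseteq> S \<and> (\<Sum>k\<in>\<D>. Sup k - Inf k) < \<delta> \<longrightarrow>
       (\<Sum>k\<in>\<D>. norm (f (Sup k) - f (Inf k))) < \<epsilon>)"

definition trajectory ::
  "('a::euclidean_space \<Rightarrow> 'a set) \<Rightarrow> real \<Rightarrow> 'a \<Rightarrow> (real \<Rightarrow> 'a) \<Rightarrow> bool" where
  "trajectory F T x0 x \<longleftrightarrow> abs_continuous_on {0..T} x \<and> x 0 = x0 \<and>
     (AE t in lebesgue. t \<in> {0..T} \<longrightarrow>
        (\<exists>v\<in>F (x t). (x has_vector_derivative v) (at t within {0..T})))"

definition min_time :: "('a::euclidean_space \<Rightarrow> 'a set) \<Rightarrow> 'a set \<Rightarrow> 'a \<Rightarrow> ereal" where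
  "min_time F K x0 = (if x0 \<in> K then 0
     else Inf {ereal T | T. T > 0 \<and> (\<exists>x. trajectory F T x0 x \<and> x T \<in> K)})"

definition controllable_set :: "('a::euclidean_space \<Rightarrow> 'a set) \<Rightarrow> 'a set \<Rightarrow> 'a set" where
  "controllable_set F K = {x. min_time F K x < \<infinity>}"

definition optimal_trajectory ::
  "('a::euclidean_space \<Rightarrow> 'a set) \<Rightarrow> 'a set \<Rightarrow> 'a \<Rightarrow> (real \<Rightarrow> 'a) \<Rightarrow> bool" where
  "optimal_trajectory F K x0 x \<longleftrightarrow>
     (let T = real_of_ereal (min_time F K x0) in trajectory F T x0 x \<and> x T \<in> K)"

text \<open>Being a solution includes that \<open>Ham F (x s)\<close> is differentiable at \<open>p s\<close> for almost every \<open>s\<close>.\<close>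

definition hamiltonian_solution ::
  "('a::euclidean_space \<Rightarrow> 'a set) \<Rightarrow> real \<Rightarrow> (real \<Rightarrow> 'a) \<Rightarrow> (real \<Rightarrow> 'a) \<Rightarrow> bool" where
  "hamiltonian_solution F T x p \<longleftrightarrow>
     (AE s in lebesgue. s \<in> {0..T} \<longrightarrow>
        (\<exists>v w. (x has_vector_derivative v) (at s within {0..T}) \<and>
               (p has_vector_derivative w) (at s within {0..T}) \<and>
               GDERIV (Ham F (x s)) (p s) :> v \<and>
               - w \<in> clarke_gradient (\<lambda>y. Ham F y (p s)) (x s)))"

definition proximal_normal_cone :: "'a::real_inner set \<Rightarrow> 'a \<Rightarrow> 'a set" where
  "proximal_normal_cone E x = {v. \<exists>\<sigma>\<ge>0. \<forall>y\<in>E. v \<bullet> (y - x) \<le> \<sigma> * (norm (y - x))\<^sup>2}"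

definition epi :: "('a \<Rightarrow> ereal) \<Rightarrow> ('a \<times> real) set" where
  "epi f = {(x, \<beta>). f x < \<infinity> \<and> f x \<le> ereal \<beta>}"

text \<open>The finiteness condition ensures that \<open>(x, f x)\<close> is a point of the epigraph.\<close>

definition proximal_subdifferential :: "('a::euclidean_space \<Rightarrow> ereal) \<Rightarrow> 'a \<Rightarrow> 'a set" where
  "proximal_subdifferential f x = {v. \<bar>f x\<bar> \<noteq> \<infinity> \<and>
     (v, - 1) \<in> proximal_normal_cone (epi f) (x, real_of_ereal (f x))}"

end

theory Submission
  imports Defs
begin

text \<open>
  Suppose \<open>- p s\<close> is a proximal subgradient at \<open>x s\<close>, let \<open>t > s\<close> be close to \<open>s\<close>, and let \<open>z\<close> be
  near \<open>x t\<close>. Solve \<open>y' = \<nabla>\<^sub>pH(y, p)\<close> backward from \<open>y t = z\<close>. As \<open>y\<close> is a trajectory of \<open>F\<close>, the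
  minimum time at \<open>y s\<close> exceeds the one at \<open>z\<close> by at most \<open>t - s\<close>. Semiconvexity of \<open>H\<close> in the state and
  the two Hamiltonian inclusions give \<open>(p \<bullet> (y - x))' \<ge> - C (norm (y - x))\<^sup>2\<close>, and \<open>norm (y - x) \<le> 2 norm (z - x t)\<close>,
  so the proximal inequality at \<open>x s\<close> tested with \<open>y s\<close> becomes the one at \<open>x t\<close> tested with \<open>z\<close>.

  At an interior time the proximal inequality tested along the optimal trajectory, where the minimum time is
  \<open>T - t\<close>, forces \<open>H(x t, p t) = 1\<close>; the endpoints follow by continuity. The same test at time \<open>0\<close> excludes
  \<open>p 0 = 0\<close>, and then \<open>p\<close> never vanishes because \<open>norm p' \<le> L norm p\<close>.
\<close>

section \<open>Absolutely continuous functions\<close>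

text \<open>Fundamental theorem of calculus for the gauge integral. At tags outside \<open>N\<close>
  the derivative controls the Riemann sum; cells tagged in \<open>N\<close> lie in an open set of
  small measure, where absolute continuity makes the increments of \<open>f\<close> small.\<close>

lemma has_integral_abs_continuous_on:
  fixes f :: "real \<Rightarrow> 'a::banach"
  assumes ac: "abs_continuous_on {a..b} f" and ab: "a \<le> b" and N: "negligible N"
    and der: "\<And>t. t \<in> {a..b} - N \<Longrightarrow> (f has_vector_derivative f' t) (at t within {a..b})"
  shows "(f' has_integral (f b - f a)) {a..b}"
proof -
  \<comment> \<open>With value zero on \<open>N\<close>, a cell tagged in \<open>N\<close>
    contributes only its increment of \<open>f\<close> to the error.\<close>
  define g where "g t = (if t \<in> N then 0 else f' t)" for t
  have "(g has_integral (f b - f a)) {a..b}"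
    unfolding has_integral_real
  proof (intro allI impI)
    fix e :: real assume e: "e > 0"
    obtain \<delta> where \<delta>: "\<delta> > 0" and ac\<delta>: "\<And>\<D>. \<lbrakk>\<D> division_of \<Union>\<D>; \<Union>\<D> \<subseteq> {a..b}; (\<Sum>k\<in>\<D>. Sup k - Inf k) < \<delta>\<rbrakk>
        \<Longrightarrow> (\<Sum>k\<in>\<D>. norm (f (Sup k) - f (Inf k))) < e / 2"
      using ac e unfolding abs_continuous_on_def by (meson half_gt_zero)
    have "N \<in> sets lebesgue" using N by (simp add: negligible_imp_sets)
    then obtain U where U: "open U" "N \<subseteq> U" "U - N \<in> lmeasurable" "emeasure lebesgue (U - N) < ennreal \<delta>"
      using sets_lebesgue_outer_open \<delta> by metis
    have Um: "U \<in> lmeasurable"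
      using U(2,3) N by (metis Diff_partition fmeasurable.Un negligible_imp_measurable)
    have "measure lebesgue (U - N) < \<delta>"
      using U(3,4) \<delta> by (simp add: emeasure_eq_measure2 ennreal_less_iff)
    moreover have "measure lebesgue (U - N) = measure lebesgue U"
      using Um N by (intro measure_Diff_null_set) (auto simp: negligible_iff_null_sets)
    ultimately have mU: "measure lebesgue U < \<delta>" by simp
    \<comment> \<open>Summed over all cells, the derivative error is at most
      \<open>\<eta> * (b - a)\<close>, hence at most \<open>e / 2\<close>; the \<open>+ 1\<close>
      covers \<open>a = b\<close>.\<close>
    define \<eta> where "\<eta> = e / (2 * (b - a + 1))"
    have \<eta>: "\<eta> > 0" using e ab by (simp add: \<eta>_def)
    have "\<forall>x. \<exists>d>0. x \<in> {a..b} - N \<longrightarrow>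
         (\<forall>y\<in>{a..b}. norm (y-x) < d \<longrightarrow> norm (f y - f x - (y-x) *\<^sub>R f' x) \<le> \<eta> * norm (y-x))"
      using der[unfolded has_vector_derivative_def has_derivative_within_alt] \<eta>
      by metis
    then obtain d where d: "\<And>x. 0 < d x"
       "\<And>x y. \<lbrakk>x \<in> {a..b} - N; y \<in> {a..b}; norm (y-x) < d x\<rbrakk>
                \<Longrightarrow> norm (f y - f x - (y-x) *\<^sub>R f' x) \<le> \<eta> * norm (y-x)"
      by metis
    define \<gamma> where "\<gamma> x = (if x \<in> N then U else ball x (d x))" for x
    have gauge: "gauge \<gamma>"
      using d(1) U(1,2) by (auto simp: gauge_def \<gamma>_def)
    have "norm ((\<Sum>(x,k)\<in>p. measure lborel k *\<^sub>R g x) - (f b - f a)) < e"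
      if p: "p tagged_division_of {a..b}" and fine: "\<gamma> fine p" for p
    proof -
      note pD = tagged_division_ofD[OF p]
      have fin: "finite p" using pD(1) .
      have ba: "(\<Sum>(x,K)\<in>p. Sup K - Inf K) = b - a" "(\<Sum>(x,K)\<in>p. f(Sup K) - f(Inf K)) = f b - f a"
        using additive_tagged_division_1[OF ab p, of "\<lambda>x. x"] additive_tagged_division_1[OF ab p, of f] by auto
      define p1 where "p1 = {(x,K)\<in>p. x \<in> N}"
      have p1: "p1 \<subseteq> p" by (auto simp: p1_def)
      have cbox: "\<exists>u v. K = {u..v} \<and> u \<le> v \<and> x \<in> {u..v} \<and> {u..v} \<subseteq> {a..b}" if "(x,K) \<in> p" for x K
        using pD(2,3,4)[OF that] by (metis atLeastAtMost_iff box_real(2) order_trans)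
      have trm: "norm (measure lborel K *\<^sub>R g x - (f (Sup K) - f (Inf K)))
            \<le> \<eta> * (Sup K - Inf K) + (if x \<in> N then norm (f (Sup K) - f (Inf K)) else 0)"
        if xK: "(x,K) \<in> p" for x K
      proof -
        obtain u v where K: "K = {u..v}" "u \<le> v" "x \<in> {u..v}" "{u..v} \<subseteq> {a..b}" using cbox[OF xK] by blast
        show ?thesis
        proof (cases "x \<in> N")
          case True then show ?thesis using K \<eta> by (simp add: g_def norm_minus_commute)
        next
          case False
          have sub: "K \<subseteq> ball x (d x)" using fine xK False by (force simp: fine_def \<gamma>_def)
          have xm: "x \<in> {a..b} - N" using K False by auto
          have "u \<in> K" "v \<in> K" using K by auto
          then have "norm (u - x) < d x" "norm (v - x) < d x" using sub by (auto simp: dist_real_def)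
          then have *: "norm (f u - f x - (u-x) *\<^sub>R f' x) \<le> \<eta> * norm (u-x)"
              "norm (f v - f x - (v-x) *\<^sub>R f' x) \<le> \<eta> * norm (v-x)"
            using d(2)[OF xm, of u] d(2)[OF xm, of v] K by auto
          have "norm ((v - u) *\<^sub>R f' x - (f v - f u)) = norm (f u - f x - (u - x) *\<^sub>R f' x - (f v - f x - (v - x) *\<^sub>R f' x))"
            by (simp add: algebra_simps)
          also have "\<dots> \<le> \<eta> * norm (u-x) + \<eta> * norm (v-x)"
            using * norm_triangle_ineq4 order_trans add_mono by (smt (verit))
          also have "\<dots> = \<eta> * (v - u)" using K by (simp add: algebra_simps)
          finally show ?thesis using K False by (simp add: g_def)
        qed
      qed
      have part: "p1 tagged_partial_division_of {a..b}"
        using p p1 by (meson tagged_division_of_def tagged_partial_division_subset)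
      then have div: "(snd ` p1) division_of \<Union>(snd ` p1)"
        by (rule partial_division_of_tagged_division)
      have "measure lebesgue k = Sup k - Inf k" if "k \<in> snd ` p1" for k
        using that cbox p1 by (force simp: measure_completion)
      then have "(\<Sum>k\<in>snd ` p1. Sup k - Inf k) = (\<Sum>k\<in>snd ` p1. measure lebesgue k)"
        by simp
      also have "\<dots> = measure lebesgue (\<Union>(snd ` p1))"
        by (rule content_division[OF div])
      also have "\<dots> \<le> measure lebesgue U"
      proof (rule measure_mono_fmeasurable)
        show "\<Union>(snd ` p1) \<subseteq> U" using fine by (force simp: p1_def fine_def \<gamma>_def)
        show "\<Union>(snd ` p1) \<in> sets lebesgue" using div by (meson fmeasurableD lmeasurable_division)
      qed (rule Um)
      finally have "(\<Sum>k\<in>snd ` p1. Sup k - Inf k) < \<delta>" using mU by simp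
      moreover have "\<Union>(snd ` p1) \<subseteq> {a..b}" using p1 pD(3) by force
      ultimately have "(\<Sum>k\<in>snd ` p1. norm (f (Sup k) - f (Inf k))) < e / 2"
        using ac\<delta> div by blast
      \<comment> \<open>Distinct tags can share a cell only if it is degenerate. Its increment is
        then zero, so summing over cells or over tagged cells gives the same value.\<close>
      moreover have "(\<Sum>k\<in>snd ` p1. norm (f (Sup k) - f (Inf k))) = (\<Sum>z\<in>p1. norm (f (Sup (snd z)) - f (Inf (snd z))))"
      proof (subst sum.reindex_nontrivial)
        show "finite p1" using fin p1 finite_subset by blast
        show "norm (f (Sup (snd z)) - f (Inf (snd z))) = 0"
          if z: "z \<in> p1" "w \<in> p1" "z \<noteq> w" "snd z = snd w" for z w
        proof -
          obtain s t K where zw: "z = (s,K)" "w = (t,K)" using z(4) by (metis prod.collapse)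
          have "interior K \<inter> interior K = {}" using pD(5)[of s K t K] z zw p1 by auto
          moreover obtain u v where K: "K = {u..v}" "u \<le> v" using cbox[of s K] z(1) zw p1 by blast
          ultimately have "u = v" by (simp add: interior_atLeastAtMost_real)
          then show ?thesis using K zw by simp
        qed
      qed (simp add: comp_def)
      ultimately have small: "(\<Sum>z\<in>p1. norm (f (Sup (snd z)) - f (Inf (snd z)))) < e / 2" by simp
      have "(\<Sum>(x,k)\<in>p. measure lborel k *\<^sub>R g x) - (f b - f a)
          = (\<Sum>(x,K)\<in>p. measure lborel K *\<^sub>R g x - (f (Sup K) - f (Inf K)))"
        unfolding ba(2)[symmetric] sum_subtractf[symmetric] by (rule sum.cong) auto
      also have "norm \<dots> \<le> (\<Sum>(x,K)\<in>p. \<eta> * (Sup K - Inf K) + (if x \<in> N then norm (f (Sup K) - f (Inf K)) else 0))"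
        by (rule sum_norm_le) (use trm in auto)
      also have "\<dots> = \<eta> * (\<Sum>(x,K)\<in>p. Sup K - Inf K) + (\<Sum>(x,K)\<in>p. if x \<in> N then norm (f (Sup K) - f (Inf K)) else 0)"
        by (simp add: sum_distrib_left sum.distrib case_prod_unfold)
      also have "(\<Sum>(x,K)\<in>p. if x \<in> N then norm (f (Sup K) - f (Inf K)) else 0) = (\<Sum>z\<in>p1. norm (f (Sup (snd z)) - f (Inf (snd z))))"
      proof -
        have "p1 = {z\<in>p. fst z \<in> N}" by (auto simp: p1_def)
        then show ?thesis using fin by (simp add: sum.inter_filter case_prod_unfold)
      qed
      also have "\<eta> * (\<Sum>(x,K)\<in>p. Sup K - Inf K) = \<eta> * (b - a)" using ba by simp
      also have "\<eta> * (b - a) \<le> e / 2"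
        using ab e by (simp add: \<eta>_def field_simps)
      finally show ?thesis using small by linarith
    qed
    then show "\<exists>\<gamma>. gauge \<gamma> \<and> (\<forall>\<D>. \<D> tagged_division_of {a..b} \<and> \<gamma> fine \<D> \<longrightarrow>
        norm ((\<Sum>(x,k)\<in>\<D>. measure lborel k *\<^sub>R g x) - (f b - f a)) < e)"
      using gauge by blast
  qed
  moreover have "f' t = g t" if "t \<in> {a..b} - N" for t
    using that by (simp add: g_def)
  ultimately show ?thesis
    using has_integral_spike[OF N] by metis
qed

lemma division_of_real_cell:
  fixes k :: "real set"
  assumes "\<D> division_of S" "k \<in> \<D>"
  shows "\<exists>u v. k = {u..v} \<and> u \<le> v \<and> Inf k = u \<and> Sup k = v \<and> u \<in> S \<and> v \<in> S"
proof -
  obtain u v where k: "k = {u..v}" using division_ofD(4)[OF assms] by auto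
  then have "u \<le> v" using division_ofD(3)[OF assms] by auto
  then show ?thesis using k division_ofD(2)[OF assms] by auto
qed

lemma abs_continuous_on_imp_continuous_on:
  fixes f :: "real \<Rightarrow> 'a::real_normed_vector"
  assumes "abs_continuous_on {a..b} f"
  shows "continuous_on {a..b} f"
  unfolding continuous_on_iff
proof (intro ballI allI impI)
  fix s and e :: real assume s: "s \<in> {a..b}" and e: "0 < e"
  obtain \<delta> where \<delta>: "\<delta> > 0" and ac: "\<And>\<D>. \<lbrakk>\<D> division_of \<Union>\<D>; \<Union>\<D> \<subseteq> {a..b}; (\<Sum>k\<in>\<D>. Sup k - Inf k) < \<delta>\<rbrakk>
        \<Longrightarrow> (\<Sum>k\<in>\<D>. norm (f (Sup k) - f (Inf k))) < e"
    using assms e unfolding abs_continuous_on_def by meson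
  have "dist (f t) (f s) < e" if t: "t \<in> {a..b}" "dist t s < \<delta>" for t
  proof -
    let ?k = "{min s t..max s t}"
    have "{?k} division_of \<Union>{?k}"
      using division_of_self[of "min s t" "max s t"] by simp
    then have "norm (f (max s t) - f (min s t)) < e"
      using ac[of "{?k}"] s t by (auto simp: dist_real_def)
    then show ?thesis by (cases "s \<le> t") (auto simp: dist_norm norm_minus_commute max_def min_def)
  qed
  then show "\<exists>d>0. \<forall>x'\<in>{a..b}. dist x' s < d \<longrightarrow> dist (f x') (f s) < e"
    using \<delta> by blast
qed

lemma abs_continuous_on_subset:
  assumes "abs_continuous_on S f" "S' \<subseteq> S"
  shows "abs_continuous_on S' f"
  using assms unfolding abs_continuous_on_def by (meson subset_trans)

lemma lipschitz_on_imp_abs_continuous_on: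
  fixes f :: "real \<Rightarrow> 'a::real_normed_vector"
  assumes L: "L-lipschitz_on S f"
  shows "abs_continuous_on S f"
  unfolding abs_continuous_on_def
proof (intro allI impI)
  fix e :: real assume e: "0 < e"
  have L0: "0 \<le> L" using lipschitz_on_nonneg[OF L] .
  have "(\<Sum>k\<in>\<D>. norm (f (Sup k) - f (Inf k))) < e"
    if D: "\<D> division_of \<Union>\<D>" "\<Union>\<D> \<subseteq> S" "(\<Sum>k\<in>\<D>. Sup k - Inf k) < e / (L + 1)" for \<D>
  proof -
    have "(\<Sum>k\<in>\<D>. norm (f (Sup k) - f (Inf k))) \<le> (\<Sum>k\<in>\<D>. L * (Sup k - Inf k))"
    proof (rule sum_mono)
      fix k assume "k \<in> \<D>"
      then obtain u v where k: "Inf k = u" "Sup k = v" "u \<le> v" "u \<in> S" "v \<in> S"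
        using division_of_real_cell[OF D(1)] D(2) by blast
      then show "norm (f (Sup k) - f (Inf k)) \<le> L * (Sup k - Inf k)"
        using lipschitz_onD[OF L, of v u] by (simp add: dist_norm)
    qed
    also have "\<dots> = L * (\<Sum>k\<in>\<D>. Sup k - Inf k)" by (simp add: sum_distrib_left)
    also have "\<dots> \<le> L * (e / (L + 1))" using D(3) L0 by (intro mult_left_mono) auto
    also have "\<dots> < e" using L0 e by (simp add: field_simps)
    finally show ?thesis .
  qed
  then show "\<exists>\<delta>>0. \<forall>\<D>. \<D> division_of \<Union>\<D> \<and> \<Union>\<D> \<subseteq> S \<and> (\<Sum>k\<in>\<D>. Sup k - Inf k) < \<delta> \<longrightarrow>
       (\<Sum>k\<in>\<D>. norm (f (Sup k) - f (Inf k))) < e"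
    using L0 e by (intro exI[of _ "e / (L + 1)"]) auto
qed

text \<open>The increment of the product splits by the Leibniz rule, and both factors are bounded on
  the compact interval.\<close>

lemma abs_continuous_on_inner:
  fixes f g :: "real \<Rightarrow> 'a::real_inner"
  assumes f: "abs_continuous_on {a..b} f" and g: "abs_continuous_on {a..b} g"
  shows "abs_continuous_on {a..b} (\<lambda>t. f t \<bullet> g t)"
  unfolding abs_continuous_on_def
proof (intro allI impI)
  fix e :: real assume e: "0 < e"
  have "bounded (f ` {a..b})" "bounded (g ` {a..b})"
    using f g by (auto intro!: compact_imp_bounded compact_continuous_image abs_continuous_on_imp_continuous_on)
  then have "bounded (f ` {a..b} \<union> g ` {a..b})" by simp
  then obtain B where B: "B > 0" "\<And>t. t \<in> {a..b} \<Longrightarrow> norm (f t) \<le> B" "\<And>t. t \<in> {a..b} \<Longrightarrow> norm (g t) \<le> B"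
    unfolding bounded_pos by auto
  define e' where "e' = e / (2 * B)"
  have e': "e' > 0" using e B by (simp add: e'_def)
  obtain \<delta>1 where \<delta>1: "\<delta>1 > 0" and ac1: "\<And>\<D>. \<lbrakk>\<D> division_of \<Union>\<D>; \<Union>\<D> \<subseteq> {a..b}; (\<Sum>k\<in>\<D>. Sup k - Inf k) < \<delta>1\<rbrakk>
        \<Longrightarrow> (\<Sum>k\<in>\<D>. norm (f (Sup k) - f (Inf k))) < e'"
    using f e' unfolding abs_continuous_on_def by meson
  obtain \<delta>2 where \<delta>2: "\<delta>2 > 0" and ac2: "\<And>\<D>. \<lbrakk>\<D> division_of \<Union>\<D>; \<Union>\<D> \<subseteq> {a..b}; (\<Sum>k\<in>\<D>. Sup k - Inf k) < \<delta>2\<rbrakk>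
        \<Longrightarrow> (\<Sum>k\<in>\<D>. norm (g (Sup k) - g (Inf k))) < e'"
    using g e' unfolding abs_continuous_on_def by meson
  have "(\<Sum>k\<in>\<D>. norm (f (Sup k) \<bullet> g (Sup k) - f (Inf k) \<bullet> g (Inf k))) < e"
    if D: "\<D> division_of \<Union>\<D>" "\<Union>\<D> \<subseteq> {a..b}" "(\<Sum>k\<in>\<D>. Sup k - Inf k) < min \<delta>1 \<delta>2" for \<D>
  proof -
    have "(\<Sum>k\<in>\<D>. norm (f (Sup k) \<bullet> g (Sup k) - f (Inf k) \<bullet> g (Inf k)))
      \<le> (\<Sum>k\<in>\<D>. B * norm (f (Sup k) - f (Inf k)) + B * norm (g (Sup k) - g (Inf k)))"
    proof (rule sum_mono)
      fix k assume "k \<in> \<D>"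
      then obtain u v where k: "Inf k = u" "Sup k = v" "u \<in> {a..b}" "v \<in> {a..b}"
        using division_of_real_cell[OF D(1)] D(2) by blast
      have "f v \<bullet> g v - f u \<bullet> g u = (f v - f u) \<bullet> g v + f u \<bullet> (g v - g u)"
        by (simp add: inner_diff)
      also have "norm \<dots> \<le> norm (f v - f u) * norm (g v) + norm (f u) * norm (g v - g u)"
        unfolding real_norm_def
        by (intro order_trans[OF abs_triangle_ineq] add_mono Cauchy_Schwarz_ineq2)
      also have "\<dots> \<le> norm (f v - f u) * B + B * norm (g v - g u)"
        using B k by (intro add_mono mult_mono) auto
      finally show "norm (f (Sup k) \<bullet> g (Sup k) - f (Inf k) \<bullet> g (Inf k))
          \<le> B * norm (f (Sup k) - f (Inf k)) + B * norm (g (Sup k) - g (Inf k))"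
        using k by (simp add: mult.commute)
    qed
    also have "\<dots> = B * (\<Sum>k\<in>\<D>. norm (f (Sup k) - f (Inf k))) + B * (\<Sum>k\<in>\<D>. norm (g (Sup k) - g (Inf k)))"
      by (simp add: sum.distrib sum_distrib_left)
    also have "\<dots> < B * e' + B * e'"
    proof -
      have "(\<Sum>k\<in>\<D>. norm (f (Sup k) - f (Inf k))) < e'" "(\<Sum>k\<in>\<D>. norm (g (Sup k) - g (Inf k))) < e'"
        using ac1[OF D(1,2)] ac2[OF D(1,2)] D(3) by auto
      then show ?thesis using B(1) by (intro add_strict_mono mult_strict_left_mono)
    qed
    also have "\<dots> = e" using B(1) by (simp add: e'_def)
    finally show ?thesis .
  qed
  then show "\<exists>\<delta>>0. \<forall>\<D>. \<D> division_of \<Union>\<D> \<and> \<Union>\<D> \<subseteq> {a..b} \<and> (\<Sum>k\<in>\<D>. Sup k - Inf k) < \<delta> \<longrightarrow>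
       (\<Sum>k\<in>\<D>. norm (f (Sup k) \<bullet> g (Sup k) - f (Inf k) \<bullet> g (Inf k))) < e"
    using \<delta>1 \<delta>2 by (intro exI[of _ "min \<delta>1 \<delta>2"]) auto
qed

section \<open>Estimates from bounds on the derivative almost everywhere\<close>

lemma abs_continuous_on_derivative_bound:
  fixes f :: "real \<Rightarrow> 'a::banach"
  assumes ac: "abs_continuous_on {a..b} f" and N: "negligible N"
    and der: "\<And>t. t \<in> {a..b} - N \<Longrightarrow> \<exists>v. (f has_vector_derivative v) (at t within {a..b}) \<and> norm v \<le> M"
    and M: "0 \<le> M" and ab: "a \<le> b"
  shows "norm (f b - f a) \<le> M * (b - a)"
proof -
  obtain f' where f': "\<And>t. t \<in> {a..b} - N \<Longrightarrow> (f has_vector_derivative f' t) (at t within {a..b}) \<and> norm (f' t) \<le> M"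
    using der by metis
  define g where "g t = (if t \<in> {a..b} - N then f' t else 0)" for t
  have g: "(g has_integral (f b - f a)) {a..b}"
    by (rule has_integral_abs_continuous_on[OF ac ab N]) (use f' in \<open>simp add: g_def\<close>)
  have "norm (f b - f a) \<le> M * measure lborel {a..b}"
    by (rule has_integral_bound_real[OF M finite.emptyI g]) (use f' M in \<open>simp add: g_def\<close>)
  then show ?thesis using ab by simp
qed

lemma abs_continuous_on_derivative_ge:
  fixes f :: "real \<Rightarrow> real"
  assumes ac: "abs_continuous_on {a..b} f" and N: "negligible N"
    and der: "\<And>t. t \<in> {a..b} - N \<Longrightarrow> \<exists>v. (f has_vector_derivative v) (at t within {a..b}) \<and> m \<le> v"
    and ab: "a \<le> b"
  shows "m * (b - a) \<le> f b - f a"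
proof -
  obtain f' where f': "\<And>t. t \<in> {a..b} - N \<Longrightarrow> (f has_vector_derivative f' t) (at t within {a..b}) \<and> m \<le> f' t"
    using der by metis
  \<comment> \<open>The default on \<open>N\<close> is \<open>m\<close>, so that the lower bound
    holds at every point when the integrals are compared.\<close>
  define g where "g t = (if t \<in> {a..b} - N then f' t else m)" for t
  have g: "(g has_integral (f b - f a)) {a..b}"
    by (rule has_integral_abs_continuous_on[OF ac ab N]) (use f' in \<open>simp add: g_def\<close>)
  have "((\<lambda>t. m) has_integral ((b - a) * m)) {a..b}"
    using has_integral_const_real[of m a b] ab by simp
  then have "(b - a) * m \<le> f b - f a"
    by (rule has_integral_le[OF _ g]) (use f' in \<open>simp add: g_def\<close>)
  then show ?thesis by (simp add: mult.commute)
qed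

lemma lipschitz_on_abs_continuous_derivative_bound:
  fixes f :: "real \<Rightarrow> 'a::banach"
  assumes ac: "abs_continuous_on {a..b} f" and N: "negligible N"
    and der: "\<And>t. t \<in> {a..b} - N \<Longrightarrow> \<exists>v. (f has_vector_derivative v) (at t within {a..b}) \<and> norm v \<le> M"
    and M: "0 \<le> M"
  shows "M-lipschitz_on {a..b} f"
proof (rule lipschitz_on_leI[OF _ M])
  fix s t assume st: "s \<in> {a..b}" "t \<in> {a..b}" "s \<le> t"
  then have sub: "{s..t} \<subseteq> {a..b}" by auto
  have "norm (f t - f s) \<le> M * (t - s)"
  proof (rule abs_continuous_on_derivative_bound[OF abs_continuous_on_subset[OF ac sub] N _ M st(3)])
    show "\<exists>v. (f has_vector_derivative v) (at u within {s..t}) \<and> norm v \<le> M" if "u \<in> {s..t} - N" for u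
      using der[of u] that sub has_vector_derivative_within_subset by (metis Diff_iff subsetD)
  qed
  then show "dist (f s) (f t) \<le> M * dist s t"
    using st by (simp add: dist_norm norm_minus_commute)
qed

lemma AE_lebesgue_iff_negligible:
  "(AE t in lebesgue. P t) \<longleftrightarrow> (\<exists>N. negligible N \<and> (\<forall>t. t \<notin> N \<longrightarrow> P t))"
  unfolding eventually_ae_filter negligible_iff_null_sets by (auto simp: Bex_def)

section \<open>Trajectories and the minimum time\<close>

lemma trajectory_iff:
  "trajectory F T x0 x \<longleftrightarrow> abs_continuous_on {0..T} x \<and> x 0 = x0 \<and>
     (\<exists>N. negligible N \<and> (\<forall>t\<in>{0..T} - N. \<exists>v\<in>F (x t). (x has_vector_derivative v) (at t within {0..T})))"
  unfolding trajectory_def AE_lebesgue_iff_negligible by blast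

lemma assumption_F_growth:
  assumes "assumption_F F" "bounded S"
  obtains M where "0 \<le> M" "\<And>y v. \<lbrakk>y \<in> S; v \<in> F y\<rbrakk> \<Longrightarrow> norm v \<le> M"
proof -
  have "\<exists>\<gamma>>0. \<forall>x. \<forall>v\<in>F x. norm v \<le> \<gamma> * (1 + norm x)"
    using assms(1) unfolding assumption_F_def by (elim conjE)
  then obtain \<gamma> where \<gamma>: "\<gamma> > 0" "\<And>y v. v \<in> F y \<Longrightarrow> norm v \<le> \<gamma> * (1 + norm y)"
    by blast
  obtain B where B: "B > 0" "\<And>y. y \<in> S \<Longrightarrow> norm y \<le> B"
    using assms(2) unfolding bounded_pos by blast
  show ?thesis
  proof
    show "0 \<le> \<gamma> * (1 + B)" using \<gamma>(1) B(1) by simp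
    show "norm v \<le> \<gamma> * (1 + B)" if "y \<in> S" "v \<in> F y" for y v
    proof -
      have "\<gamma> * (1 + norm y) \<le> \<gamma> * (1 + B)" using B(2)[OF that(1)] \<gamma>(1) by simp
      then show ?thesis using \<gamma>(2)[OF that(2)] by simp
    qed
  qed
qed

text \<open>The arc has bounded image, so (F3) bounds its speed. Lipschitz continuity passes easily
  to shifted and concatenated arcs, and implies absolute continuity there.\<close>

lemma trajectory_lipschitz:
  assumes F: "assumption_F F" and tr: "trajectory F T x0 x"
  obtains M where "M-lipschitz_on {0..T} x"
proof -
  obtain N where ac: "abs_continuous_on {0..T} x" and N: "negligible N"
    and der: "\<And>t. t \<in> {0..T} - N \<Longrightarrow> \<exists>v\<in>F (x t). (x has_vector_derivative v) (at t within {0..T})"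
    using tr unfolding trajectory_iff by blast
  have "bounded (x ` {0..T})"
    using ac by (auto intro!: compact_imp_bounded compact_continuous_image abs_continuous_on_imp_continuous_on)
  then obtain M where M: "0 \<le> M" "\<And>y v. \<lbrakk>y \<in> x ` {0..T}; v \<in> F y\<rbrakk> \<Longrightarrow> norm v \<le> M"
    using assumption_F_growth[OF F] by metis
  have "M-lipschitz_on {0..T} x"
    by (rule lipschitz_on_abs_continuous_derivative_bound[OF ac N _ M(1)])
       (use der M(2) in blast)
  then show ?thesis using that by blast
qed

lemma has_vector_derivative_shift:
  fixes x :: "real \<Rightarrow> 'a::real_normed_vector"
  assumes "(x has_vector_derivative v) (at (s + t) within S)" "(\<lambda>u. s + u) ` S' \<subseteq> S"
  shows "((\<lambda>u. x (s + u)) has_vector_derivative v) (at t within S')"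
proof -
  have "((\<lambda>u. s + u) has_vector_derivative 1) (at t within S')"
    by (auto intro!: derivative_eq_intros)
  then have "((x \<circ> (\<lambda>u. s + u)) has_vector_derivative (1 *\<^sub>R v)) (at t within S')"
    by (rule vector_diff_chain_within) (use assms has_vector_derivative_within_subset in blast)
  then show ?thesis by (simp add: comp_def)
qed

lemma trajectory_shift:
  assumes F: "assumption_F F" and tr: "trajectory F T x0 x" and s: "0 \<le> s" "s + d \<le> T"
  shows "trajectory F d (x s) (\<lambda>t. x (s + t))"
proof -
  obtain N where N: "negligible N"
    and der: "\<And>t. t \<in> {0..T} - N \<Longrightarrow> \<exists>v\<in>F (x t). (x has_vector_derivative v) (at t within {0..T})"
    using tr unfolding trajectory_iff by blast
  obtain M where M: "M-lipschitz_on {0..T} x" using trajectory_lipschitz[OF F tr] by blast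
  have "M-lipschitz_on {0..d} (\<lambda>t. x (s + t))"
  proof (rule lipschitz_onI)
    show "dist (x (s + t)) (x (s + u)) \<le> M * dist t u" if "t \<in> {0..d}" "u \<in> {0..d}" for t u
      using lipschitz_onD[OF M, of "s + t" "s + u"] that s by (auto simp: dist_real_def)
  qed (use lipschitz_on_nonneg[OF M] in auto)
  then have "abs_continuous_on {0..d} (\<lambda>t. x (s + t))"
    by (rule lipschitz_on_imp_abs_continuous_on)
  moreover have "negligible ((+) (- s) ` N)" using N by (rule negligible_translation)
  moreover have "\<exists>v\<in>F (x (s + t)). ((\<lambda>t. x (s + t)) has_vector_derivative v) (at t within {0..d})"
    if t: "t \<in> {0..d} - (+) (- s) ` N" for t
  proof -
    have "s + t \<notin> N" using t by (metis Diff_iff add.commute add_diff_cancel_left' image_eqI uminus_add_conv_diff)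
    then obtain v where "v \<in> F (x (s + t))" "(x has_vector_derivative v) (at (s + t) within {0..T})"
      using der[of "s + t"] t s by auto
    then show ?thesis using has_vector_derivative_shift[of x v s t "{0..T}" "{0..d}"] s by auto
  qed
  ultimately show ?thesis unfolding trajectory_iff by auto
qed

lemma trajectory_concat:
  assumes F: "assumption_F F" and x: "trajectory F a x0 x" and y: "trajectory F b (x a) y"
    and a: "0 \<le> a" and b: "0 \<le> b"
  shows "trajectory F (a + b) x0 (\<lambda>t. if t \<le> a then x t else y (t - a))" (is "trajectory _ _ _ ?w")
proof -
  obtain N1 where N1: "negligible N1"
    and der1: "\<And>t. t \<in> {0..a} - N1 \<Longrightarrow> \<exists>v\<in>F (x t). (x has_vector_derivative v) (at t within {0..a})"
    using x unfolding trajectory_iff by blast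
  obtain N2 where N2: "negligible N2"
    and der2: "\<And>t. t \<in> {0..b} - N2 \<Longrightarrow> \<exists>v\<in>F (y t). (y has_vector_derivative v) (at t within {0..b})"
    using y unfolding trajectory_iff by blast
  have x0: "x 0 = x0" and y0: "y 0 = x a" using x y by (auto simp: trajectory_iff)
  obtain M1 where M1: "M1-lipschitz_on {0..a} x" using trajectory_lipschitz[OF F x] by blast
  obtain M2 where M2: "M2-lipschitz_on {0..b} y" using trajectory_lipschitz[OF F y] by blast
  define M where "M = max M1 M2"
  have M1': "M-lipschitz_on {0..a} x" using M1 lipschitz_on_le M_def by (metis max.cobounded1)
  have "M-lipschitz_on {a..a+b} (\<lambda>t. y (t - a))"
  proof (rule lipschitz_onI)
    show "dist (y (t - a)) (y (u - a)) \<le> M * dist t u" if "t \<in> {a..a+b}" "u \<in> {a..a+b}" for t u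
    proof -
      have "M-lipschitz_on {0..b} y" using M2 lipschitz_on_le M_def by (metis max.cobounded2)
      then show ?thesis
        using lipschitz_onD[of M "{0..b}" y "t - a" "u - a"] that by (auto simp: dist_real_def)
    qed
  qed (use lipschitz_on_nonneg[OF M1'] in auto)
  then have "M-lipschitz_on {0..a+b} ?w"
    by (rule lipschitz_on_concat[OF M1']) (simp add: y0)
  then have ac: "abs_continuous_on {0..a+b} ?w"
    by (rule lipschitz_on_imp_abs_continuous_on)
  \<comment> \<open>The junction time joins the exceptional set because the one-sided derivatives of
    the two pieces may differ there.\<close>
  define N where "N = insert a (N1 \<union> (+) a ` N2)"
  have "negligible ((+) a ` N2)" using N2 by (rule negligible_translation)
  then have N: "negligible N" using N1 by (simp add: N_def)
  have "\<exists>v\<in>F (?w t). (?w has_vector_derivative v) (at t within {0..a+b})"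
    if t: "t \<in> {0..a+b} - N" for t
  proof (cases "t < a")
    case True
    then obtain v where v: "v \<in> F (x t)" "(x has_vector_derivative v) (at t within {0..a})"
      using der1[of t] t by (auto simp: N_def)
    have "(?w has_vector_derivative v) (at t within {0..a})"
      by (rule has_vector_derivative_transform[OF _ _ v(2)]) (use t True in auto)
    moreover have "at t within {0..a} = at t within {0..a+b}"
      by (rule at_within_nhd[of t "{..<a}"]) (use True b in auto)
    ultimately show ?thesis using v True by auto
  next
    case False
    then have ta: "a < t" using t by (auto simp: N_def)
    have "t - a \<notin> N2" using t by (force simp: N_def)
    then obtain v where v: "v \<in> F (y (t - a))" "(y has_vector_derivative v) (at (- a + t) within {0..b})"
      using der2[of "t - a"] t ta by auto
    have "((\<lambda>u. y (- a + u)) has_vector_derivative v) (at t within {a..a+b})"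
      by (rule has_vector_derivative_shift[OF v(2)]) auto
    then have "(?w has_vector_derivative v) (at t within {a..a+b})"
      by (rule has_vector_derivative_transform[rotated 2]) (use t ta y0 in auto)
    moreover have "at t within {a..a+b} = at t within {0..a+b}"
      by (rule at_within_nhd[of t "{a<..}"]) (use ta a in auto)
    ultimately show ?thesis using v ta by auto
  qed
  then show ?thesis
    using ac N x0 a unfolding trajectory_iff by (intro conjI exI[of _ N]) auto
qed

section \<open>Dynamic programming and the minimum time along an optimal trajectory\<close>

lemma min_time_nonneg: "0 \<le> min_time F K x0"
  unfolding min_time_def by (auto intro!: Inf_greatest)

text \<open>Any continuation from \<open>x T\<close> to the target can be appended to
  \<open>x\<close>. The case split follows the definition of \<open>min_time\<close>, which treats
  target points separately and admits only positive times.\<close>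

lemma min_time_trajectory_le:
  assumes F: "assumption_F F" and x: "trajectory F T x0 x" and T: "0 \<le> T"
  shows "min_time F K x0 \<le> ereal T + min_time F K (x T)"
proof -
  consider "x0 \<in> K" | "T = 0" | "0 < T" "x0 \<notin> K" "x T \<in> K" | "0 < T" "x0 \<notin> K" "x T \<notin> K"
    using T by force
  then show ?thesis
  proof cases
    case 1 then show ?thesis using T min_time_nonneg[of F K "x T"] by (simp add: min_time_def)
  next
    case 2 then show ?thesis using x by (simp add: trajectory_iff)
  next
    case 3
    then have "min_time F K x0 \<le> ereal T"
      using x by (auto simp: min_time_def intro!: Inf_lower)
    then show ?thesis using 3 by (simp add: min_time_def)
  next
    case 4
    \<comment> \<open>With \<open>T\<close> on the left the right side is a bare infimum, tested
      against one continuation at a time; an empty family needs no separate case.\<close>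
    have "min_time F K x0 - ereal T \<le> min_time F K (x T)"
      unfolding min_time_def[of F K "x T"] if_not_P[OF 4(3)]
    proof (rule Inf_greatest, clarify)
      fix S y assume S: "0 < S" "trajectory F S (x T) y" "y S \<in> K"
      have tr: "trajectory F (T + S) x0 (\<lambda>t. if t \<le> T then x t else y (t - T))"
        using trajectory_concat[OF F x S(2)] S T by simp
      have "min_time F K x0 \<le> ereal (T + S)"
        unfolding min_time_def if_not_P[OF 4(2)]
      proof (rule Inf_lower, rule CollectI, intro exI conjI)
        show "trajectory F (T + S) x0 (\<lambda>t. if t \<le> T then x t else y (t - T))" by (rule tr)
      qed (use S T in auto)
      then show "min_time F K x0 - ereal T \<le> ereal S"
        by (simp add: ereal_minus_le add.commute)
    qed
    then show ?thesis by (simp add: ereal_minus_le add.commute)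
  qed
qed

text \<open>The tail of the optimal trajectory gives the upper bound. A smaller value at
  \<open>x t\<close> would, by dynamic programming from \<open>x0\<close>, beat the optimal time
  \<open>T\<close>.\<close>

lemma min_time_along_optimal:
  assumes F: "assumption_F F" and x: "trajectory F T x0 x" and T: "min_time F K x0 = ereal T"
    and xT: "x T \<in> K" and t: "0 \<le> t" "t \<le> T"
  shows "min_time F K (x t) = ereal (T - t)"
proof (rule antisym)
  have "trajectory F (T - t) (x t) (\<lambda>s. x (t + s))"
    using trajectory_shift[OF F x, of t "T - t"] t by simp
  then have "min_time F K (x t) \<le> ereal (T - t) + min_time F K (x (t + (T - t)))"
    using min_time_trajectory_le[OF F] t by fastforce
  then show "min_time F K (x t) \<le> ereal (T - t)"
    using xT by (simp add: min_time_def[of F K "x T"])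
  have x0: "x 0 = x0" using x by (simp add: trajectory_iff)
  have "trajectory F t x0 x"
    using trajectory_shift[OF F x, of 0 t] t x0 by simp
  then have "ereal T \<le> ereal t + min_time F K (x t)"
    using min_time_trajectory_le[OF F, of t x0 x K] t T by simp
  then show "ereal (T - t) \<le> min_time F K (x t)"
    by (cases "min_time F K (x t)") auto
qed

section \<open>The Hamiltonian and its Clarke gradient\<close>

lemma assumption_F_values:
  assumes "assumption_F F"
  shows "compact (F x)" "F x \<noteq> {}"
  using assms by (auto simp: assumption_F_def)

lemma Ham_upper:
  assumes "assumption_F F" "v \<in> F x"
  shows "v \<bullet> p \<le> Ham F x p"
proof -
  have "bounded ((\<lambda>v. v \<bullet> p) ` F x)"
    using assumption_F_values(1)[OF assms(1)] by (intro compact_imp_bounded compact_continuous_image continuous_intros)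
  then show ?thesis
    unfolding Ham_def using assms(2) by (intro cSUP_upper bounded_imp_bdd_above)
qed

lemma Ham_attained:
  assumes "assumption_F F"
  obtains v where "v \<in> F x" "v \<bullet> p = Ham F x p"
proof -
  have "continuous_on (F x) (\<lambda>v. v \<bullet> p)" by (intro continuous_intros)
  then obtain v where v: "v \<in> F x" "\<And>w. w \<in> F x \<Longrightarrow> w \<bullet> p \<le> v \<bullet> p"
    using continuous_attains_sup[OF assumption_F_values[OF assms]] by blast
  have "Ham F x p \<le> v \<bullet> p"
    unfolding Ham_def using assumption_F_values(2)[OF assms] v(2) by (rule cSUP_least)
  then have "v \<bullet> p = Ham F x p" using Ham_upper[OF assms v(1), of p] by simp
  then show ?thesis using that v(1) by blast
qed

text \<open>Negating the covector exchanges maximum and minimum; this turns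
  \<open>Ham F (x t) (p t) = 1\<close> into the claim on \<open>min_Ham\<close>.\<close>

lemma min_Ham_uminus:
  assumes "assumption_F F"
  shows "min_Ham F x (- p) = - Ham F x p"
proof -
  obtain v where v: "v \<in> F x" "v \<bullet> p = Ham F x p" using Ham_attained[OF assms] .
  show ?thesis
    unfolding min_Ham_def
  proof (rule cInf_eq_minimum)
    show "- Ham F x p \<in> (\<lambda>v. v \<bullet> - p) ` F x" using v by force
    show "- Ham F x p \<le> z" if "z \<in> (\<lambda>v. v \<bullet> - p) ` F x" for z
      using that Ham_upper[OF assms] by auto
  qed
qed

text \<open>Positive homogeneity carries semiconvexity from the unit sphere to every nonzero
  covector.\<close>

lemma Ham_scaleR:
  assumes "assumption_F F" "0 \<le> s"
  shows "Ham F x (s *\<^sub>R p) = s * Ham F x p"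
proof (rule antisym)
  obtain v where v: "v \<in> F x" "v \<bullet> (s *\<^sub>R p) = Ham F x (s *\<^sub>R p)" using Ham_attained[OF assms(1)] .
  show "Ham F x (s *\<^sub>R p) \<le> s * Ham F x p"
    using v(2) Ham_upper[OF assms(1) v(1), of p] assms(2) by (simp add: mult_left_mono flip: v(2))
  obtain w where w: "w \<in> F x" "w \<bullet> p = Ham F x p" using Ham_attained[OF assms(1)] .
  show "s * Ham F x p \<le> Ham F x (s *\<^sub>R p)"
    using w(2) Ham_upper[OF assms(1) w(1), of "s *\<^sub>R p"] by simp
qed

text \<open>For a maximizer \<open>v\<close>, the function \<open>Ham F x q - v \<bullet> q\<close>
  of \<open>q\<close> is minimal at \<open>p\<close>, so its gradient \<open>g - v\<close> vanishes
  there.\<close>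

lemma Ham_gradient_unique:
  assumes F: "assumption_F F" and g: "GDERIV (Ham F x) p :> g" and v: "v \<in> F x" "v \<bullet> p = Ham F x p"
  shows "v = g"
proof -
  have "((\<lambda>q. Ham F x q - v \<bullet> q) has_derivative (\<lambda>h. h \<bullet> g - v \<bullet> h)) (at p)"
    using g unfolding gderiv_def by (auto intro!: derivative_eq_intros)
  moreover have "\<forall>\<^sub>F q in at p. Ham F x p - v \<bullet> p \<le> Ham F x q - v \<bullet> q"
    using Ham_upper[OF F v(1)] v(2) by (simp add: always_eventually)
  ultimately have "(\<lambda>h. h \<bullet> g - v \<bullet> h) = (\<lambda>h. 0)"
    by (rule has_derivative_local_min)
  \<comment> \<open>Evaluating the zero derivative in the direction \<open>g - v\<close> produces
    the squared norm.\<close>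
  then have "(g - v) \<bullet> g - v \<bullet> (g - v) = 0" by metis
  then have "(g - v) \<bullet> (g - v) = 0" by (simp add: inner_diff inner_commute)
  then show ?thesis by simp
qed

text \<open>A maximizer exists and must equal the gradient. Hence an arc driven by the gradient has
  velocities in \<open>F\<close>, and pairing them with \<open>p\<close> recovers the
  Hamiltonian.\<close>

lemma Ham_gradient:
  assumes F: "assumption_F F" and g: "GDERIV (Ham F x) p :> g"
  shows "g \<in> F x" "g \<bullet> p = Ham F x p"
proof -
  obtain v where "v \<in> F x" "v \<bullet> p = Ham F x p" using Ham_attained[OF F] .
  then show "g \<in> F x" "g \<bullet> p = Ham F x p" using Ham_gradient_unique[OF F g] by auto
qed

text \<open>The gradient at \<open>p\<close> is the only maximizer of \<open>\<lambda>v. v \<bullet> p\<close> on the compact set \<open>F x\<close>, so its graph is closed.\<close>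

lemma continuous_on_Ham_gradient:
  fixes F :: "'a::euclidean_space \<Rightarrow> 'a set"
  assumes F: "assumption_F F" and G: "\<And>p. p \<noteq> 0 \<Longrightarrow> GDERIV (Ham F x) p :> G p"
  shows "continuous_on (- {0}) G"
proof -
  have img: "G \<in> - {0} \<rightarrow> F x" using Ham_gradient(1)[OF F G] by auto
  have "continuous_on (- {0}) (Ham F x)"
    using G by (intro continuous_at_imp_continuous_on)
       (auto simp: gderiv_def intro: has_derivative_continuous)
  then have "continuous_on ((- {0}) \<times> F x) (\<lambda>z. Ham F x (fst z))"
    by (rule continuous_on_compose2[OF _ continuous_on_fst[OF continuous_on_id]]) auto
  then have "continuous_on ((- {0}) \<times> F x) (\<lambda>z. snd z \<bullet> fst z - Ham F x (fst z))"
    by (intro continuous_intros)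
  then have "closedin (top_of_set ((- {0}) \<times> F x))
       (((- {0}) \<times> F x) \<inter> (\<lambda>z. snd z \<bullet> fst z - Ham F x (fst z)) -` {0})"
    by (rule continuous_closedin_preimage) simp
  moreover have "((- {0}) \<times> F x) \<inter> (\<lambda>z. snd z \<bullet> fst z - Ham F x (fst z)) -` {0} = (\<lambda>p. (p, G p)) ` (- {0})"
    using Ham_gradient[OF F G] Ham_gradient_unique[OF F G] by fastforce
  ultimately show ?thesis
    using continuous_closed_graph_eq[OF assumption_F_values(1)[OF F] img] by simp
qed

text \<open>By (F2) a maximizer over \<open>F x\<close> is within \<open>L * norm (y - x)\<close> of
  a point of \<open>F y\<close>. The factor \<open>norm p\<close> stays explicit to make the bound
  on the velocity of the dual arc linear in \<open>p\<close>.\<close>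

lemma Ham_lipschitz:
  fixes F :: "'a::euclidean_space \<Rightarrow> 'a set"
  assumes F: "assumption_F F" and Q: "compact Q"
  obtains L where "L > 0" "\<And>x y p. \<lbrakk>x \<in> Q; y \<in> Q\<rbrakk> \<Longrightarrow> \<bar>Ham F x p - Ham F y p\<bar> \<le> L * norm p * norm (x - y)"
proof -
  have "\<exists>L>0. \<forall>x\<in>Q. \<forall>y\<in>Q. F x \<subseteq> {w + (L * norm (y - x)) *\<^sub>R b | w b. w \<in> F y \<and> b \<in> cball 0 1}"
    using F unfolding assumption_F_def by - (elim conjE, erule allE[where x = Q], erule mp, rule Q)
  then obtain L where L: "L > 0" and sub: "\<And>x y. \<lbrakk>x \<in> Q; y \<in> Q\<rbrakk> \<Longrightarrow>
      F x \<subseteq> {w + (L * norm (y - x)) *\<^sub>R b | w b. w \<in> F y \<and> b \<in> cball 0 1}"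
    by blast
  have *: "Ham F x p - Ham F y p \<le> L * norm p * norm (x - y)" if xy: "x \<in> Q" "y \<in> Q" for x y p
  proof -
    obtain v where v: "v \<in> F x" "v \<bullet> p = Ham F x p"
      using Ham_attained[OF F] .
    then obtain w b where w: "w \<in> F y" "v = w + (L * norm (y - x)) *\<^sub>R b" "norm b \<le> 1"
      using sub[OF xy] v(1) by fastforce
    have "b \<bullet> p \<le> norm b * norm p" by (rule norm_cauchy_schwarz)
    also have "\<dots> \<le> norm p" using w(3) by (simp add: mult_left_le_one_le)
    finally have bp: "b \<bullet> p \<le> norm p" .
    have "Ham F x p = w \<bullet> p + (L * norm (y - x)) * (b \<bullet> p)" using v(2) w(2) by (simp add: inner_add_left)
    also have "\<dots> \<le> Ham F y p + (L * norm (y - x)) * norm p"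
      using Ham_upper[OF F w(1)] bp L by (intro add_mono mult_left_mono) auto
    finally show ?thesis by (simp add: norm_minus_commute mult_ac)
  qed
  show ?thesis
  proof (rule that[OF L])
    show "\<bar>Ham F x p - Ham F y p\<bar> \<le> L * norm p * norm (x - y)" if "x \<in> Q" "y \<in> Q" for x y p
      using *[OF that, of p] *[OF that(2,1), of p] by (simp add: norm_minus_commute abs_le_iff)
  qed
qed

text \<open>Halving the increment repeatedly turns the midpoint inequality into the gradient inequality; the errors
  form a geometric series.\<close>

lemma semiconvex_on_gradient_ineq:
  fixes f :: "'a::euclidean_space \<Rightarrow> real"
  assumes sc: "semiconvex_on c \<Omega> f" and \<Omega>: "convex \<Omega>" and xy: "x \<in> \<Omega>" "y \<in> \<Omega>"
    and g: "GDERIV f x :> g"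
  shows "f x + g \<bullet> (y - x) - c / 2 * (norm (y - x))\<^sup>2 \<le> f y"
proof -
  define u where "u = y - x"
  define \<phi> where "\<phi> t = f (x + t *\<^sub>R u)" for t
  define h where "h n = (1 / 2 :: real) ^ n" for n
  have hpos: "0 < h n" and h1: "h n \<le> 1" and hS: "h (Suc n) = h n / 2" for n
    by (auto simp: h_def power_le_one)
  have mem: "x + t *\<^sub>R u \<in> \<Omega>" if "0 \<le> t" "t \<le> 1" for t
  proof -
    have "(1 - t) *\<^sub>R x + t *\<^sub>R y \<in> \<Omega>" using \<Omega> xy that by (simp add: convexD_alt)
    then show ?thesis by (simp add: u_def algebra_simps)
  qed
  have step: "(\<phi> (h n) - \<phi> 0) / h n + c / 2 * (norm u)\<^sup>2 * h (Suc n) \<ge> (\<phi> (h (Suc n)) - \<phi> 0) / h (Suc n)" for n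
  proof -
    \<comment> \<open>Center and half-step are chosen so that the segment runs from \<open>x\<close>
      to \<open>x + h n *\<^sub>R u\<close>; its midpoint is the point for
      \<open>h (Suc n)\<close>.\<close>
    let ?m = "x + (h n / 2) *\<^sub>R u" and ?k = "(h n / 2) *\<^sub>R u"
    have e: "?m - ?k = x" "?m + ?k = x + h n *\<^sub>R u"
      by (simp_all add: add.assoc flip: scaleR_left.add)
    have "closed_segment (?m - ?k) (?m + ?k) \<subseteq> \<Omega>"
      unfolding e by (intro closed_segment_subset xy \<Omega> mem less_imp_le[OF hpos] h1)
    then have "f (?m + ?k) + f (?m - ?k) - 2 * f ?m \<ge> - c * (norm ?k)\<^sup>2"
      using sc unfolding semiconvex_on_def by blast
    then have "\<phi> (h n) + \<phi> 0 - 2 * \<phi> (h n / 2) \<ge> - c * ((h n / 2)\<^sup>2 * (norm u)\<^sup>2)"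
      unfolding e using hpos[of n] by (simp add: \<phi>_def power_mult_distrib power_divide)
    then have "2 * (\<phi> (h n / 2) - \<phi> 0) \<le> \<phi> (h n) - \<phi> 0 + c / 4 * (norm u)\<^sup>2 * h n * h n"
      by (simp add: power_divide power2_eq_square algebra_simps)
    then have "2 * (\<phi> (h n / 2) - \<phi> 0) / h n \<le> (\<phi> (h n) - \<phi> 0 + c / 4 * (norm u)\<^sup>2 * h n * h n) / h n"
      using hpos[of n] by (intro divide_right_mono) auto
    then show ?thesis unfolding hS using hpos[of n] by (simp add: add_divide_distrib mult.commute)
  qed
  \<comment> \<open>The errors telescope: \<open>h 1\<close>, ..., \<open>h n\<close> sum to
    \<open>1 - h n\<close>, which leaves the constant \<open>c / 2\<close> in the limit.\<close>
  have lower: "(\<phi> (h n) - \<phi> 0) / h n - c / 2 * (norm u)\<^sup>2 * (1 - h n) \<le> f y - f x" for n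
  proof (induction n)
    case 0 then show ?case by (simp add: h_def \<phi>_def u_def)
  next
    case (Suc n)
    have "c / 2 * (norm u)\<^sup>2 * (1 - h (Suc n)) = c / 2 * (norm u)\<^sup>2 * (1 - h n) + c / 2 * (norm u)\<^sup>2 * h (Suc n)"
      unfolding hS by (simp add: field_simps)
    then show ?case using step[of n] Suc by linarith
  qed
  have "(\<phi> has_derivative (\<lambda>t. (t *\<^sub>R u) \<bullet> g)) (at 0)"
  proof -
    have "((\<lambda>t. x + t *\<^sub>R u) has_derivative (\<lambda>t. t *\<^sub>R u)) (at 0)"
      by (auto intro!: derivative_eq_intros)
    moreover have "(f has_derivative (\<lambda>k. k \<bullet> g)) (at (x + 0 *\<^sub>R u))"
      using g by (simp add: gderiv_def)
    ultimately show ?thesis unfolding \<phi>_def by (rule has_derivative_compose)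
  qed
  then have "(\<phi> has_field_derivative (u \<bullet> g)) (at 0)"
    by (simp add: has_field_derivative_def mult_commute_abs)
  then have "(\<lambda>t. (\<phi> t - \<phi> 0) / t) \<midarrow>0\<rightarrow> u \<bullet> g"
    by (simp add: DERIV_def)
  moreover have hlim: "h \<longlonglongrightarrow> 0" unfolding h_def by (intro LIMSEQ_power_zero) simp
  moreover have "filterlim h (at 0) sequentially"
    using hlim hpos by (auto simp: filterlim_at less_imp_neq[symmetric] intro!: always_eventually)
  ultimately have "(\<lambda>n. (\<phi> (h n) - \<phi> 0) / h n) \<longlonglongrightarrow> u \<bullet> g"
    using filterlim_compose by blast
  then have "(\<lambda>n. (\<phi> (h n) - \<phi> 0) / h n - c / 2 * (norm u)\<^sup>2 * (1 - h n)) \<longlonglongrightarrow> u \<bullet> g - c / 2 * (norm u)\<^sup>2 * (1 - 0)"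
    by (intro tendsto_intros hlim)
  then have "u \<bullet> g - c / 2 * (norm u)\<^sup>2 * (1 - 0) \<le> f y - f x"
    by (rule LIMSEQ_le_const2) (use lower in blast)
  then show ?thesis by (simp add: u_def inner_commute)
qed

text \<open>For fixed \<open>x\<close> and \<open>y\<close> the inequality describes a half-space of
  vectors. It contains all limits of nearby gradients, as the gradient inequality passes to the
  limit, and therefore their convex hull.\<close>

lemma semiconvex_on_clarke_ineq:
  fixes f :: "'a::euclidean_space \<Rightarrow> real"
  assumes sc: "semiconvex_on c \<Omega> f" and \<Omega>: "convex \<Omega>" "open \<Omega>" and xy: "x \<in> \<Omega>" "y \<in> \<Omega>"
    and w: "w \<in> clarke_gradient f x"
  shows "f x + w \<bullet> (y - x) - c / 2 * (norm (y - x))\<^sup>2 \<le> f y"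
proof -
  let ?S = "{v. v \<bullet> (y - x) \<le> f y - f x + c / 2 * (norm (y - x))\<^sup>2}"
  have "convex ?S" using convex_halfspace_le[of "y - x"] by (simp add: inner_commute)
  moreover have "v \<in> ?S" if v: "z \<longlonglongrightarrow> x" "\<forall>i::nat. GDERIV f (z i) :> g i" "g \<longlonglongrightarrow> v" for z g v
  proof -
    have "isCont f x"
      using sc \<Omega> xy(1) by (auto simp: semiconvex_on_def continuous_on_eq_continuous_at)
    then have "(\<lambda>i. f (z i)) \<longlonglongrightarrow> f x" using v(1) isCont_tendsto_compose by blast
    then have "(\<lambda>i. f (z i) + g i \<bullet> (y - z i) - c / 2 * (norm (y - z i))\<^sup>2) \<longlonglongrightarrow>
        f x + v \<bullet> (y - x) - c / 2 * (norm (y - x))\<^sup>2"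
      using v by (intro tendsto_intros)
    moreover have "\<forall>\<^sub>F i in sequentially. f (z i) + g i \<bullet> (y - z i) - c / 2 * (norm (y - z i))\<^sup>2 \<le> f y"
      using topological_tendstoD[OF v(1) \<Omega>(2) xy(1)]
      by eventually_elim (use semiconvex_on_gradient_ineq[OF sc \<Omega>(1) _ xy(2)] v(2) in blast)
    ultimately have "f x + v \<bullet> (y - x) - c / 2 * (norm (y - x))\<^sup>2 \<le> f y"
      by (rule tendsto_upperbound) simp
    then show ?thesis by simp
  qed
  ultimately have "clarke_gradient f x \<subseteq> ?S"
    unfolding clarke_gradient_def by (intro hull_minimal) auto
  then show ?thesis using w by auto
qed

text \<open>Moving along \<open>g\<close> itself changes \<open>f\<close> at rate
  \<open>norm g\<close> per unit length, which the Lipschitz bound caps.\<close>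

lemma gradient_norm_le_lipschitz:
  fixes f :: "'a::real_inner \<Rightarrow> real"
  assumes g: "GDERIV f x :> g" and \<Omega>: "open \<Omega>" "x \<in> \<Omega>" and L: "0 \<le> L"
    and lip: "\<And>y. y \<in> \<Omega> \<Longrightarrow> \<bar>f y - f x\<bar> \<le> L * norm (y - x)"
  shows "norm g \<le> L"
proof (cases "g = 0")
  case True then show ?thesis using L by simp
next
  case False
  show ?thesis
  proof (rule field_le_epsilon)
    fix e :: real assume e: "0 < e"
    obtain d where d: "d > 0" "\<And>y. norm (y - x) < d \<Longrightarrow> norm (f y - f x - (y - x) \<bullet> g) \<le> e * norm (y - x)"
      using g e unfolding gderiv_def has_derivative_at_alt by blast
    obtain r where r: "r > 0" "ball x r \<subseteq> \<Omega>" using \<Omega> by (meson openE)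
    \<comment> \<open>The displacement \<open>s *\<^sub>R g\<close> has length
      \<open>min d r / 2\<close>, inside both the radius of the derivative estimate and the ball in
      \<open>\<Omega>\<close>.\<close>
    define s where "s = min d r / (2 * norm g)"
    have s: "s > 0" using d r False by (simp add: s_def)
    have sg: "s * norm g < d" "s * norm g < r" using d(1) r(1) False by (auto simp: s_def)
    let ?y = "x + s *\<^sub>R g"
    have "?y \<in> \<Omega>" using r(2) sg s by (auto simp: dist_norm subset_iff)
    then have 1: "\<bar>f ?y - f x\<bar> \<le> L * (s * norm g)" using lip[of ?y] s by simp
    have 2: "\<bar>f ?y - f x - s * (norm g)\<^sup>2\<bar> \<le> e * (s * norm g)"
      using d(2)[of ?y] sg s by (simp add: power2_norm_eq_inner)
    have "(s * norm g) * norm g \<le> (s * norm g) * (L + e)"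
      using 1 2 by (simp add: algebra_simps power2_eq_square abs_le_iff)
    then show "norm g \<le> L + e" using s False by (simp add: mult_le_cancel_left)
  qed
qed

text \<open>The norm bound survives limits, and the closed ball is convex, so the hull stays inside
  it. This bounds the velocity of the dual arc.\<close>

lemma clarke_gradient_norm_le_lipschitz:
  fixes f :: "'a::euclidean_space \<Rightarrow> real"
  assumes \<Omega>: "open \<Omega>" "x \<in> \<Omega>" and L: "0 \<le> L"
    and lip: "\<And>y z. \<lbrakk>y \<in> \<Omega>; z \<in> \<Omega>\<rbrakk> \<Longrightarrow> \<bar>f y - f z\<bar> \<le> L * norm (y - z)"
    and w: "w \<in> clarke_gradient f x"
  shows "norm w \<le> L"
proof -
  have "v \<in> cball 0 L" if v: "z \<longlonglongrightarrow> x" "\<forall>i::nat. GDERIV f (z i) :> g i" "g \<longlonglongrightarrow> v" for z g v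
  proof -
    have "\<forall>\<^sub>F i in sequentially. norm (g i) \<le> L"
      using topological_tendstoD[OF v(1) \<Omega>]
      by eventually_elim (use gradient_norm_le_lipschitz[OF _ \<Omega>(1) _ L lip] v(2) in blast)
    then have "norm v \<le> L"
      using tendsto_upperbound[OF tendsto_norm[OF v(3)]] by simp
    then show ?thesis by simp
  qed
  then have "clarke_gradient f x \<subseteq> cball 0 L"
    unfolding clarke_gradient_def by (intro hull_minimal) auto
  then show ?thesis using w by auto
qed

text \<open>After normalizing \<open>p\<close>, homogeneity multiplies the semiconvexity constant of
  the unit sphere by \<open>norm p\<close>.\<close>

lemma Ham_clarke_ineq:
  fixes F :: "'a::euclidean_space \<Rightarrow> 'a set"
  assumes F: "assumption_F F" and sc: "\<forall>p\<in>sphere 0 1. semiconvex_on c (ball 0 r) (\<lambda>x. Ham F x p)"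
    and xy: "x \<in> ball 0 r" "y \<in> ball 0 r" and w: "w \<in> clarke_gradient (\<lambda>y. Ham F y p) x" and p: "p \<noteq> 0"
  shows "Ham F x p + w \<bullet> (y - x) - c * norm p / 2 * (norm (y - x))\<^sup>2 \<le> Ham F y p"
proof -
  define q where "q = p /\<^sub>R norm p"
  have q: "q \<in> sphere 0 1" using p by (simp add: q_def)
  have "p = norm p *\<^sub>R q" using p by (simp add: q_def)
  then have H: "Ham F z p = norm p * Ham F z q" for z
    using Ham_scaleR[OF F, of "norm p" z q] by simp
  have scq: "semiconvex_on c (ball 0 r) (\<lambda>x. Ham F x q)" using sc q by blast
  have "semiconvex_on (c * norm p) (ball 0 r) (\<lambda>x. Ham F x p)"
    unfolding semiconvex_on_def
  proof (intro conjI allI impI)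
    show "continuous_on (ball 0 r) (\<lambda>x. Ham F x p)"
      using scq unfolding H semiconvex_on_def by (intro continuous_intros) auto
    fix z k :: 'a assume "closed_segment (z - k) (z + k) \<subseteq> ball 0 r"
    then have "- c * (norm k)\<^sup>2 \<le> Ham F (z + k) q + Ham F (z - k) q - 2 * Ham F z q"
      using scq unfolding semiconvex_on_def by blast
    then have "norm p * (- c * (norm k)\<^sup>2) \<le> norm p * (Ham F (z + k) q + Ham F (z - k) q - 2 * Ham F z q)"
      by (rule mult_left_mono) simp
    then show "- (c * norm p) * (norm k)\<^sup>2 \<le> Ham F (z + k) p + Ham F (z - k) p - 2 * Ham F z p"
      unfolding H by (simp add: algebra_simps)
  qed
  then show ?thesis
    by (rule semiconvex_on_clarke_ineq[OF _ _ _ xy w]) auto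
qed

section \<open>Short-time estimates and backward solutions\<close>

lemma lipschitz_on_derivative_bound:
  fixes f :: "real \<Rightarrow> 'a::banach"
  assumes der: "\<And>t. t \<in> {a..b} \<Longrightarrow> (f has_vector_derivative f' t) (at t within {a..b})"
    and bd: "\<And>t. t \<in> {a..b} \<Longrightarrow> norm (f' t) \<le> M" and M: "0 \<le> M"
  shows "M-lipschitz_on {a..b} f"
proof (rule lipschitz_on_leI[OF _ M])
  fix s t assume st: "s \<in> {a..b}" "t \<in> {a..b}" "s \<le> t"
  then have "(f' has_integral (f t - f s)) {s..t}"
    by (intro fundamental_theorem_of_calculus has_vector_derivative_within_subset[OF der]) auto
  then have "norm (f t - f s) \<le> M * measure lborel {s..t}"
    by (rule has_integral_bound_real[OF M finite.emptyI]) (use st bd in auto)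
  then show "dist (f s) (f t) \<le> M * dist s t"
    using st by (simp add: dist_norm norm_minus_commute)
qed

text \<open>A substitute for Gronwall's inequality: from the time \<open>u\<close> where the norm is
  largest up to \<open>b\<close>, the arc moves by at most half of \<open>norm (f u)\<close>, so at
  least half of it is left at \<open>b\<close>.\<close>

lemma short_time_backward_bound:
  fixes f :: "real \<Rightarrow> 'a::banach"
  assumes ac: "abs_continuous_on {a..b} f" and N: "negligible N"
    and der: "\<And>t. t \<in> {a..b} - N \<Longrightarrow> \<exists>v. (f has_vector_derivative v) (at t within {a..b}) \<and> norm v \<le> L * norm (f t)"
    and L: "0 \<le> L" "L * (b - a) \<le> 1 / 2" and t: "t \<in> {a..b}"
  shows "norm (f t) \<le> 2 * norm (f b)"
proof -
  have "continuous_on {a..b} (\<lambda>t. norm (f t))"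
    using abs_continuous_on_imp_continuous_on[OF ac] by (rule continuous_on_norm)
  then obtain u where u: "u \<in> {a..b}" "\<And>s. s \<in> {a..b} \<Longrightarrow> norm (f s) \<le> norm (f u)"
    using continuous_attains_sup[of "{a..b}" "\<lambda>t. norm (f t)"] t by auto
  have sub: "{u..b} \<subseteq> {a..b}" using u(1) by auto
  have "norm (f b - f u) \<le> (L * norm (f u)) * (b - u)"
  proof (rule abs_continuous_on_derivative_bound[OF abs_continuous_on_subset[OF ac sub] N])
    show "\<exists>v. (f has_vector_derivative v) (at s within {u..b}) \<and> norm v \<le> L * norm (f u)"
      if s: "s \<in> {u..b} - N" for s
    proof -
      obtain v where v: "(f has_vector_derivative v) (at s within {a..b})" "norm v \<le> L * norm (f s)"
        using der[of s] s sub by auto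
      have "L * norm (f s) \<le> L * norm (f u)" using u(2)[of s] s sub L(1) by (intro mult_left_mono) auto
      then show ?thesis using has_vector_derivative_within_subset[OF v(1) sub] v(2) by fastforce
    qed
  qed (use L u in auto)
  also have "\<dots> = (L * (b - u)) * norm (f u)" by simp
  also have "\<dots> \<le> (1 / 2) * norm (f u)"
  proof (rule mult_right_mono)
    have "L * (b - u) \<le> L * (b - a)" using L(1) u(1) by (intro mult_left_mono) auto
    then show "L * (b - u) \<le> 1 / 2" using L(2) by simp
  qed simp
  finally have "norm (f u) \<le> 2 * norm (f b)"
    using norm_triangle_ineq2[of "f u" "f b"] by (simp add: norm_minus_commute)
  then show ?thesis using u(2)[OF t] by simp
qed

text \<open>Picard's fixed-point argument: on so short an interval the integral operator halves
  uniform distances.\<close>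

lemma backward_ode_short_time:
  fixes f :: "real \<Rightarrow> 'a::euclidean_space \<Rightarrow> 'a"
  assumes ab: "a \<le> b"
    and cont: "\<And>y. continuous_on {a..b} y \<Longrightarrow> continuous_on {a..b} (\<lambda>t. f t (y t))"
    and lip: "\<And>t u v. t \<in> {a..b} \<Longrightarrow> norm (f t u - f t v) \<le> L * norm (u - v)"
    and L: "0 \<le> L" "L * (b - a) \<le> 1 / 2"
  obtains y where "y b = z" "\<And>t. t \<in> {a..b} \<Longrightarrow> (y has_vector_derivative f t (y t)) (at t within {a..b})"
proof -
  \<comment> \<open>Clamping time to the interval makes each iterate a bounded continuous function
    on the whole line, an element of the complete space \<open>bcontfun\<close>.\<close>
  define c where "c s = max a (min b s)" for s
  have c: "c s \<in> {a..b}" for s using ab by (auto simp: c_def)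
  have c_id: "c s = s" if "s \<in> {a..b}" for s using that by (auto simp: c_def)
  define J where "J y s = z - integral {s..b} (\<lambda>t. f t (y t))" for y s
  have contf: "continuous_on {a..b} (\<lambda>t. f t (apply_bcontfun y t))" for y
    by (rule cont) simp
  have J: "(\<lambda>s. J (apply_bcontfun y) (c s)) \<in> bcontfun" for y
  proof -
    have cJ: "continuous_on {a..b} (J (apply_bcontfun y))"
      unfolding J_def
      by (intro continuous_intros indefinite_integral_continuous_1' integrable_continuous_real contf)
    moreover have "continuous_on UNIV c" unfolding c_def by (intro continuous_intros)
    ultimately have "continuous_on UNIV (\<lambda>s. J (apply_bcontfun y) (c s))"
      by (rule continuous_on_compose2) (use c in auto)
    moreover have "bounded (range (\<lambda>s. J (apply_bcontfun y) (c s)))"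
      by (rule bounded_subset[OF compact_imp_bounded[OF compact_continuous_image[OF cJ]]]) (use c in auto)
    ultimately show ?thesis by (simp add: bcontfun_def)
  qed
  define \<Phi> where "\<Phi> y = Bcontfun (\<lambda>s. J (apply_bcontfun y) (c s))" for y
  have \<Phi>: "apply_bcontfun (\<Phi> y) s = J (apply_bcontfun y) (c s)" for y s
    unfolding \<Phi>_def by (simp add: Bcontfun_inverse[OF J])
  have "dist (\<Phi> y1) (\<Phi> y2) \<le> 1 / 2 * dist y1 y2" for y1 y2
  proof (rule dist_bound)
    fix s
    have sub: "{c s..b} \<subseteq> {a..b}" using c[of s] by auto
    have ci: "continuous_on {c s..b} (\<lambda>t. f t (apply_bcontfun y t))" for y
      using continuous_on_subset[OF contf sub] .
    have "J (apply_bcontfun y1) (c s) - J (apply_bcontfun y2) (c s)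
        = integral {c s..b} (\<lambda>t. f t (apply_bcontfun y2 t) - f t (apply_bcontfun y1 t))"
      unfolding J_def by (simp add: integral_diff integrable_continuous_real ci)
    also have "norm \<dots> \<le> L * dist y1 y2 * (b - c s)"
    proof (rule integral_bound)
      fix t assume t: "t \<in> {c s..b}"
      have "norm (f t (apply_bcontfun y2 t) - f t (apply_bcontfun y1 t)) \<le> L * norm (apply_bcontfun y2 t - apply_bcontfun y1 t)"
        using t sub by (intro lip) auto
      also have "\<dots> \<le> L * dist y1 y2"
        using dist_bounded[of y1 t y2] L(1) by (intro mult_left_mono) (auto simp: dist_norm norm_minus_commute)
      finally show "norm (f t (apply_bcontfun y2 t) - f t (apply_bcontfun y1 t)) \<le> L * dist y1 y2" .
    qed (use c[of s] ci in \<open>auto intro!: continuous_intros\<close>)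
    also have "\<dots> = (L * (b - c s)) * dist y1 y2" by simp
    also have "\<dots> \<le> 1 / 2 * dist y1 y2"
    proof (rule mult_right_mono)
      have "L * (b - c s) \<le> L * (b - a)" using L(1) c[of s] by (intro mult_left_mono) auto
      then show "L * (b - c s) \<le> 1 / 2" using L(2) by simp
    qed simp
    finally show "dist (apply_bcontfun (\<Phi> y1) s) (apply_bcontfun (\<Phi> y2) s) \<le> 1 / 2 * dist y1 y2"
      by (simp add: \<Phi> dist_norm)
  qed
  then have "\<exists>!y. \<Phi> y = y" by (intro banach_fix_type[of "1 / 2"]) auto
  then obtain Y where Y: "\<Phi> Y = Y" by blast
  define y where "y = apply_bcontfun Y"
  have y: "y s = J y s" if "s \<in> {a..b}" for s
    using \<Phi>[of Y s] c_id[OF that] by (simp add: Y y_def)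
  show ?thesis
  proof
    show "y b = z" using y[of b] ab by (simp add: J_def)
    fix t assume t: "t \<in> {a..b}"
    let ?g = "\<lambda>t. f t (y t)"
    have g: "continuous_on {a..b} ?g" unfolding y_def by (rule contf)
    have "((\<lambda>s. z - integral {a..b} ?g + integral {a..s} ?g) has_vector_derivative (0 + f t (y t))) (at t within {a..b})"
      by (intro has_vector_derivative_add has_vector_derivative_const integral_has_vector_derivative[OF g t])
    then have der: "((\<lambda>s. z - integral {a..b} ?g + integral {a..s} ?g) has_vector_derivative f t (y t)) (at t within {a..b})"
      by simp
    \<comment> \<open>The fixed point has a moving lower limit of integration; a moving upper limit
      gives the form whose derivative is known.\<close>
    have eq: "y s = z - integral {a..b} ?g + integral {a..s} ?g" if s: "s \<in> {a..b}" for s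
    proof -
      have "integral {a..b} ?g = integral {a..s} ?g + integral {s..b} ?g"
        using s by (intro Henstock_Kurzweil_Integration.integral_combine[symmetric] integrable_continuous_real[OF g]) auto
      moreover have "y s = z - integral {s..b} ?g" using y[OF s] by (simp add: J_def)
      ultimately show ?thesis by (simp add: diff_add_eq_diff_diff_swap)
    qed
    show "(y has_vector_derivative f t (y t)) (at t within {a..b})"
      by (rule has_vector_derivative_transform[OF t eq der])
  qed
qed

text \<open>One step length serves everywhere, so finitely many steps suffice; the station before
  \<open>t\<close> is \<open>max 0 (t - \<delta>)\<close>.\<close>

lemma interval_step_induct:
  fixes t :: real
  assumes \<delta>: "0 < \<delta>" and P0: "P 0" and t: "0 \<le> t" "t \<le> T"
    and step: "\<And>s t. \<lbrakk>0 \<le> s; s \<le> t; t \<le> T; t - s \<le> \<delta>; P s\<rbrakk> \<Longrightarrow> P t"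
  shows "P t"
proof -
  have "\<forall>t. 0 \<le> t \<and> t \<le> T \<and> t \<le> real k * \<delta> \<longrightarrow> P t" for k
  proof (induction k)
    case 0 then show ?case using P0 by (metis antisym mult_zero_left of_nat_0)
  next
    case (Suc k)
    show ?case
    proof (intro allI impI)
      fix t assume t: "0 \<le> t \<and> t \<le> T \<and> t \<le> real (Suc k) * \<delta>"
      have "P (max 0 (t - \<delta>))" using Suc t \<delta> by (auto simp: algebra_simps max_def)
      then show "P t" using t \<delta> by (intro step[of "max 0 (t - \<delta>)" t]) auto
    qed
  qed
  moreover obtain k where "t \<le> real k * \<delta>"
    using reals_Archimedean3[OF \<delta>] less_imp_le by blast
  ultimately show ?thesis using t by blast
qed

section \<open>Transport of proximal subgradients\<close>

lemma proximal_subdifferential_iff: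
  assumes "f x = ereal \<tau>"
  shows "v \<in> proximal_subdifferential f x \<longleftrightarrow> (\<exists>\<sigma>\<ge>0. \<forall>y \<beta>. f y \<le> ereal \<beta> \<longrightarrow>
     v \<bullet> (y - x) - (\<beta> - \<tau>) \<le> \<sigma> * ((norm (y - x))\<^sup>2 + (\<beta> - \<tau>)\<^sup>2))"
proof -
  have "f y < \<infinity> \<and> f y \<le> ereal \<beta> \<longleftrightarrow> f y \<le> ereal \<beta>" for y \<beta>
    by (cases "f y") auto
  then show ?thesis
    unfolding proximal_subdifferential_def proximal_normal_cone_def epi_def
    by (simp add: assms norm_Pair algebra_simps)
qed

text \<open>At distance at least \<open>e\<close> from \<open>x\<close>, enlarging
  \<open>\<sigma>\<close> lets the quadratic term dominate, so only nearby \<open>y\<close> have to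
  be tested, though with every \<open>\<beta>\<close>.\<close>

lemma proximal_subdifferential_localI:
  assumes x: "f x = ereal \<tau>" and e: "0 < e" and \<sigma>: "0 \<le> \<sigma>"
    and loc: "\<And>y \<beta>. \<lbrakk>norm (y - x) < e; f y \<le> ereal \<beta>\<rbrakk> \<Longrightarrow>
       v \<bullet> (y - x) - (\<beta> - \<tau>) \<le> \<sigma> * ((norm (y - x))\<^sup>2 + (\<beta> - \<tau>)\<^sup>2)"
  shows "v \<in> proximal_subdifferential f x"
  unfolding proximal_subdifferential_iff[of f x \<tau>, OF x]
proof (intro exI conjI allI impI)
  \<comment> \<open>Far from \<open>x\<close>, \<open>norm v / e\<close> absorbs the linear term,
    and \<open>1 / e\<^sup>2 + 1\<close> absorbs \<open>- b\<close> through
    \<open>- b \<le> 1 + b\<^sup>2\<close>.\<close>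
  let ?\<sigma> = "\<sigma> + (norm v / e + 1 / e\<^sup>2 + 1)"
  show "0 \<le> ?\<sigma>" using \<sigma> e by simp
  fix y \<beta> assume y: "f y \<le> ereal \<beta>"
  define d b where "d = norm (y - x)" and "b = \<beta> - \<tau>"
  have extra: "0 \<le> norm v / e + 1 / e\<^sup>2 + 1" using e by simp
  show "v \<bullet> (y - x) - (\<beta> - \<tau>) \<le> ?\<sigma> * ((norm (y - x))\<^sup>2 + (\<beta> - \<tau>)\<^sup>2)"
  proof (cases "norm (y - x) < e")
    case True
    have "\<sigma> * ((norm (y - x))\<^sup>2 + (\<beta> - \<tau>)\<^sup>2) \<le> ?\<sigma> * ((norm (y - x))\<^sup>2 + (\<beta> - \<tau>)\<^sup>2)"
      using extra by (intro mult_right_mono) auto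
    then show ?thesis using loc[OF True y] by linarith
  next
    case False
    then have de: "1 \<le> d / e" using e by (simp add: d_def)
    then have de2: "1 \<le> d\<^sup>2 / e\<^sup>2" using power_mono[of 1 "d / e" 2] by (simp add: power_divide)
    have "v \<bullet> (y - x) \<le> norm v * d" unfolding d_def by (rule norm_cauchy_schwarz)
    also have "\<dots> \<le> norm v * d * (d / e)"
      using mult_left_mono[OF de, of "norm v * d"] by (simp add: d_def)
    finally have 1: "v \<bullet> (y - x) \<le> norm v / e * d\<^sup>2" by (simp add: power2_eq_square)
    have "0 \<le> (b + 1 / 2)\<^sup>2" by simp
    then have "- b \<le> 1 + b\<^sup>2" by (simp add: power2_sum power_divide)
    then have 2: "- b \<le> 1 / e\<^sup>2 * d\<^sup>2 + b\<^sup>2" using de2 by simp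
    have "0 \<le> \<sigma> * (d\<^sup>2 + b\<^sup>2)" "0 \<le> norm v / e * b\<^sup>2" "0 \<le> 1 / e\<^sup>2 * b\<^sup>2" "0 \<le> d\<^sup>2" using \<sigma> e by auto
    then have "v \<bullet> (y - x) - b \<le> ?\<sigma> * (d\<^sup>2 + b\<^sup>2)"
      using 1 2 unfolding distrib_right distrib_left by linarith
    then show ?thesis by (simp add: d_def b_def)
  qed
qed

text \<open>The constants of (F) and (H) are fixed on one ball. It contains a margin of one around
  the optimal trajectory, which keeps the perturbed arcs inside.\<close>

locale dual_arc =
  fixes F :: "'a::euclidean_space \<Rightarrow> 'a set" and K :: "'a set" and x0 :: 'a
    and x p :: "real \<Rightarrow> 'a" and T :: real and N :: "real set"
    and r c L\<^sub>G L\<^sub>p :: real and G :: "'a \<Rightarrow> 'a \<Rightarrow> 'a"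
  assumes F: "assumption_F F"
    and x: "trajectory F T x0 x" and T: "min_time F K x0 = ereal T" and xT: "x T \<in> K"
    and p: "abs_continuous_on {0..T} p"
    and N: "negligible N"
    and system: "\<And>s. s \<in> {0..T} - N \<Longrightarrow> \<exists>v w. (x has_vector_derivative v) (at s within {0..T}) \<and>
               (p has_vector_derivative w) (at s within {0..T}) \<and>
               GDERIV (Ham F (x s)) (p s) :> v \<and>
               - w \<in> clarke_gradient (\<lambda>y. Ham F y (p s)) (x s)"
    and x_bound: "\<And>s. s \<in> {0..T} \<Longrightarrow> norm (x s) + 1 < r"
    and c: "0 \<le> c" and semiconvex: "\<forall>p\<in>sphere 0 1. semiconvex_on c (ball 0 r) (\<lambda>x. Ham F x p)"
    and G: "\<And>q y. \<lbrakk>q \<noteq> 0; y \<in> ball 0 r\<rbrakk> \<Longrightarrow> GDERIV (Ham F y) q :> G y q"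
    and G_lip: "\<And>q. q \<noteq> 0 \<Longrightarrow> L\<^sub>G-lipschitz_on (ball 0 r) (\<lambda>y. G y q)"
    and L\<^sub>p: "0 \<le> L\<^sub>p"
    and Ham_lip: "\<And>y z q. \<lbrakk>y \<in> ball 0 r; z \<in> ball 0 r\<rbrakk> \<Longrightarrow> \<bar>Ham F y q - Ham F z q\<bar> \<le> L\<^sub>p * norm q * norm (y - z)"
begin

section \<open>Elementary properties of the fixed pair of arcs\<close>

lemma T_nonneg: "0 \<le> T"
  using min_time_nonneg[of F K x0] T by simp

lemma x_ball: "s \<in> {0..T} \<Longrightarrow> x s \<in> ball 0 r"
  using x_bound[of s] by simp

lemma x_continuous: "continuous_on {0..T} x" and p_continuous: "continuous_on {0..T} p"
  using x p by (auto simp: trajectory_iff intro: abs_continuous_on_imp_continuous_on)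

lemma min_time_x: "t \<in> {0..T} \<Longrightarrow> min_time F K (x t) = ereal (T - t)"
  using min_time_along_optimal[OF F x T xT] by simp

lemma L\<^sub>G_nonneg: "0 \<le> L\<^sub>G"
proof -
  obtain q :: 'a where "q \<noteq> 0" by (metis nonzero_Basis SOME_Basis)
  then show ?thesis using lipschitz_on_nonneg[OF G_lip] by blast
qed

lemma G_unique: "\<lbrakk>q \<noteq> 0; y \<in> ball 0 r; GDERIV (Ham F y) q :> v\<rbrakk> \<Longrightarrow> v = G y q"
  using Ham_gradient_unique[OF F G] Ham_gradient[OF F] by blast

text \<open>Freezing the state costs at most \<open>L\<^sub>G * norm (u t - u s)\<close>, uniformly
  in the covector; what remains is continuity in the covector alone.\<close>

lemma continuous_on_G:
  assumes u: "continuous_on S u" and q: "continuous_on S q"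
    and ball: "\<And>s. s \<in> S \<Longrightarrow> u s \<in> ball 0 r" and q0: "\<And>s. s \<in> S \<Longrightarrow> q s \<noteq> 0"
  shows "continuous_on S (\<lambda>s. G (u s) (q s))"
  unfolding continuous_on_def
proof
  fix s assume s: "s \<in> S"
  have cG: "continuous_on (- {0}) (G (u s))"
    by (rule continuous_on_Ham_gradient[OF F]) (use G ball s in blast)
  have "continuous_on S (\<lambda>t. G (u s) (q t))"
    by (rule continuous_on_compose2[OF cG q]) (use q0 in auto)
  then have "((\<lambda>t. norm (G (u s) (q t) - G (u s) (q s))) \<longlongrightarrow> 0) (at s within S)"
    using s unfolding continuous_on_def by (metis LIM_zero tendsto_norm_zero)
  moreover have "((\<lambda>t. norm (u t - u s)) \<longlongrightarrow> 0) (at s within S)"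
    using s u unfolding continuous_on_def by (metis LIM_zero tendsto_norm_zero)
  ultimately have lim: "((\<lambda>t. L\<^sub>G * norm (u t - u s) + norm (G (u s) (q t) - G (u s) (q s))) \<longlongrightarrow> L\<^sub>G * 0 + 0) (at s within S)"
    by (intro tendsto_intros)
  have "norm (G (u t) (q t) - G (u s) (q s)) \<le> L\<^sub>G * norm (u t - u s) + norm (G (u s) (q t) - G (u s) (q s))"
    if t: "t \<in> S" for t
  proof -
    have "norm (G (u t) (q t) - G (u s) (q t)) \<le> L\<^sub>G * norm (u t - u s)"
      by (rule lipschitz_on_normD[OF G_lip[OF q0[OF t]] ball[OF t] ball[OF s]])
    moreover have "norm (G (u t) (q t) - G (u s) (q s)) \<le>
        norm (G (u t) (q t) - G (u s) (q t)) + norm (G (u s) (q t) - G (u s) (q s))"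
      by norm
    ultimately show ?thesis by linarith
  qed
  then have "\<forall>\<^sub>F t in at s within S. norm (G (u t) (q t) - G (u s) (q s)) \<le> L\<^sub>G * norm (u t - u s) + norm (G (u s) (q t) - G (u s) (q s))"
    by (simp add: eventually_at_filter)
  then have "((\<lambda>t. G (u t) (q t) - G (u s) (q s)) \<longlongrightarrow> 0) (at s within S)"
    by (rule Lim_null_comparison) (use lim in simp)
  then show "((\<lambda>t. G (u t) (q t)) \<longlongrightarrow> G (u s) (q s)) (at s within S)"
    by (simp add: LIM_zero_iff)
qed

text \<open>The Clarke gradient bound makes the speed of \<open>p\<close> at most
  \<open>L\<^sub>p\<close> times its norm, so vanishing at \<open>t\<close> would force vanishing at
  \<open>s\<close>.\<close>

lemma p_nonzero_step:
  assumes st: "0 \<le> s" "s \<le> t" "t \<le> T" "L\<^sub>p * (t - s) \<le> 1 / 2" and ps: "p s \<noteq> 0"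
  shows "p t \<noteq> 0"
proof -
  have sub: "{s..t} \<subseteq> {0..T}" using st by auto
  have "norm (p s) \<le> 2 * norm (p t)"
  proof (rule short_time_backward_bound[OF abs_continuous_on_subset[OF p sub] N _ L\<^sub>p])
    fix u assume u: "u \<in> {s..t} - N"
    then have u': "u \<in> {0..T} - N" using sub by auto
    obtain w where w: "(p has_vector_derivative w) (at u within {0..T})"
      "- w \<in> clarke_gradient (\<lambda>y. Ham F y (p u)) (x u)" using system[OF u'] by blast
    have "norm (- w) \<le> L\<^sub>p * norm (p u)"
      using u' L\<^sub>p
      by (intro clarke_gradient_norm_le_lipschitz[OF open_ball x_ball _ Ham_lip w(2)]) auto
    then show "\<exists>v. (p has_vector_derivative v) (at u within {s..t}) \<and> norm v \<le> L\<^sub>p * norm (p u)"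
      using has_vector_derivative_within_subset[OF w(1) sub] by auto
  qed (use st in auto)
  then show ?thesis using ps by auto
qed

lemma p_nonzero:
  assumes p0: "p 0 \<noteq> 0" and t: "t \<in> {0..T}"
  shows "p t \<noteq> 0"
\<comment> \<open>This length ensures \<open>L\<^sub>p * (t - s) \<le> 1 / 2\<close>; the
  \<open>+ 1\<close> guards against \<open>L\<^sub>p = 0\<close>.\<close>
proof (rule interval_step_induct[where P = "\<lambda>t. p t \<noteq> 0" and T = T and \<delta> = "1 / (2 * (L\<^sub>p + 1))"])
  show "p t \<noteq> 0" if st: "0 \<le> s" "s \<le> t" "t \<le> T" "t - s \<le> 1 / (2 * (L\<^sub>p + 1))" "p s \<noteq> 0" for s t
  proof (rule p_nonzero_step[OF st(1-3) _ st(5)])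
    have "L\<^sub>p * (t - s) \<le> L\<^sub>p * (1 / (2 * (L\<^sub>p + 1)))" using st L\<^sub>p by (intro mult_left_mono) auto
    also have "\<dots> \<le> 1 / 2" using L\<^sub>p by (simp add: field_simps)
    finally show "L\<^sub>p * (t - s) \<le> 1 / 2" .
  qed
qed (use p0 t L\<^sub>p in auto)

text \<open>Near \<open>x t\<close>, a point \<open>z\<close> is reached at time \<open>t\<close> by the arc \<open>y\<close> with \<open>y' = \<nabla>\<^sub>pH(y, p)\<close>. Along it
  \<open>p \<bullet> (y - x)\<close> is almost nondecreasing by semiconvexity, and the minimum time decreases at most at unit rate. Both
  minimum times shift by \<open>t - s\<close>, so the increment in the epigraph variable is the same at \<open>s\<close> and at \<open>t\<close>.\<close>

lemma proximal_step:
  assumes st: "0 \<le> s" "s \<le> t" "t \<le> T" "L\<^sub>G * (t - s) \<le> 1 / 2"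
    and p0: "\<And>u. u \<in> {0..T} \<Longrightarrow> p u \<noteq> 0"
    and prox: "- p s \<in> proximal_subdifferential (min_time F K) (x s)"
  shows "- p t \<in> proximal_subdifferential (min_time F K) (x t)"
proof -
  have sub: "{s..t} \<subseteq> {0..T}" using st by auto
  obtain \<sigma> where \<sigma>: "0 \<le> \<sigma>" and prox_s: "\<And>y \<beta>. min_time F K y \<le> ereal \<beta> \<Longrightarrow>
      - p s \<bullet> (y - x s) - (\<beta> - (T - s)) \<le> \<sigma> * ((norm (y - x s))\<^sup>2 + (\<beta> - (T - s))\<^sup>2)"
    using prox proximal_subdifferential_iff[of "min_time F K" "x s" "T - s"] min_time_x[of s] st by auto
  have "bounded (p ` {0..T})"
    by (intro compact_imp_bounded compact_continuous_image p_continuous) auto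
  then obtain P where P: "P > 0" "\<And>u. u \<in> {0..T} \<Longrightarrow> norm (p u) \<le> P"
    unfolding bounded_pos by auto
  obtain M where M: "M-lipschitz_on {0..T} x" using trajectory_lipschitz[OF F x] .
  \<comment> \<open>The maximum of \<open>norm (x u)\<close> is attained, so the closed ball holding
    the unit margin can have radius strictly below \<open>r\<close>.\<close>
  obtain R where R: "R < r" "\<And>u. u \<in> {0..T} \<Longrightarrow> norm (x u) + 1 \<le> R"
  proof -
    obtain u where u: "u \<in> {0..T}" "\<And>v. v \<in> {0..T} \<Longrightarrow> norm (x v) \<le> norm (x u)"
      using continuous_attains_sup[OF _ _ continuous_on_norm[OF x_continuous]] T_nonneg by auto
    then show ?thesis using that[of "norm (x u) + 1"] x_bound[of u] by auto
  qed
  have "norm (x 0) + 1 \<le> R" using R(2)[of 0] T_nonneg by simp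
  then have R0: "0 \<le> R" using norm_ge_zero[of "x 0"] by linarith
  \<comment> \<open>Projection onto the ball is nonexpansive, so composing with it makes the
    velocity field globally Lipschitz with constant \<open>L\<^sub>G\<close>, as the backward
    solution requires.\<close>
  define cl where "cl = closest_point (cball (0::'a) R)"
  have cl: "cl y \<in> ball 0 r" for y
    using closest_point_in_set[of "cball (0::'a) R" y] R0 R(1) by (auto simp: cl_def)
  have cl_lip: "norm (cl y - cl z) \<le> norm (y - z)" for y z
    using closest_point_lipschitz[of "cball (0::'a) R" y z] R0 by (simp add: cl_def dist_norm)
  have cl_id: "cl y = y" if "norm y \<le> R" for y
    using that by (simp add: cl_def closest_point_self)
  have cl_cont: "continuous_on UNIV cl"
    unfolding cl_def using R0 by (intro continuous_on_closest_point) auto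
  define f where "f u y = G (cl y) (p u)" for u y
  \<comment> \<open>Semiconvexity contributes \<open>c * P / 2\<close> times the squared deviation,
    and the deviation is at most \<open>2 * d\<close>.\<close>
  define C where "C = 2 * c * P"
  show ?thesis
  \<comment> \<open>Starting below \<open>1 / 2\<close>, the doubled deviation stays below the
    margin of one. \<open>4 * \<sigma>\<close> comes from squaring that factor two,
    \<open>C * T\<close> from the accumulated semiconvexity error.\<close>
  proof (rule proximal_subdifferential_localI[where e = "1 / 2" and \<sigma> = "4 * \<sigma> + C * T"])
    show "min_time F K (x t) = ereal (T - t)" using min_time_x st by simp
    have C0: "0 \<le> C" using c P by (simp add: C_def)
    then show "0 \<le> 4 * \<sigma> + C * T" using \<sigma> T_nonneg by simp
    fix z \<beta> assume z: "norm (z - x t) < 1 / 2" and \<beta>: "min_time F K z \<le> ereal \<beta>"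
    obtain y where yt: "y t = z" and y': "\<And>u. u \<in> {s..t} \<Longrightarrow> (y has_vector_derivative f u (y u)) (at u within {s..t})"
    proof (rule backward_ode_short_time[where f = f and z = z, OF st(2) _ _ L\<^sub>G_nonneg st(4)])
      show "continuous_on {s..t} (\<lambda>u. f u (y u))" if "continuous_on {s..t} y" for y
        unfolding f_def
        by (intro continuous_on_G continuous_on_compose2[OF cl_cont that] continuous_on_subset[OF p_continuous sub])
           (use cl p0 sub in auto)
      show "norm (f u y1 - f u y2) \<le> L\<^sub>G * norm (y1 - y2)" if "u \<in> {s..t}" for u y1 y2
      proof -
        have "norm (f u y1 - f u y2) \<le> L\<^sub>G * norm (cl y1 - cl y2)"
          unfolding f_def using that sub p0 cl by (intro lipschitz_on_normD[OF G_lip]) auto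
        also have "\<dots> \<le> L\<^sub>G * norm (y1 - y2)" by (intro mult_left_mono cl_lip L\<^sub>G_nonneg)
        finally show ?thesis .
      qed
    qed (use that in blast)
    have f_F: "f u w \<in> F (cl w)" if "u \<in> {s..t}" for u w
      unfolding f_def using that sub p0 by (intro Ham_gradient(1)[OF F G[OF _ cl]]) auto
    obtain B where B: "0 \<le> B" "\<And>w v. \<lbrakk>w \<in> ball 0 r; v \<in> F w\<rbrakk> \<Longrightarrow> norm v \<le> B"
      using assumption_F_growth[OF F bounded_ball] by metis
    have y_lip: "B-lipschitz_on {s..t} y"
      by (rule lipschitz_on_derivative_bound[OF y' _ B(1)]) (use B(2) cl f_F in blast)+
    define w where "w u = y u - x u" for u
    have "(B + M)-lipschitz_on {s..t} w"
    proof (rule lipschitz_onI)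
      fix u v assume uv: "u \<in> {s..t}" "v \<in> {s..t}"
      have "norm (w u - w v) \<le> norm (y u - y v) + norm (x u - x v)"
        unfolding w_def by norm
      then show "dist (w u) (w v) \<le> (B + M) * dist u v"
        using lipschitz_onD[OF y_lip uv] lipschitz_onD[OF M, of u v] uv sub
        by (auto simp: dist_norm distrib_right)
    qed (use B(1) lipschitz_on_nonneg[OF M] in auto)
    then have w_ac: "abs_continuous_on {s..t} w" by (rule lipschitz_on_imp_abs_continuous_on)
    \<comment> \<open>The optimal arc solves the same projected equation, since \<open>cl\<close> is
      the identity along it.\<close>
    have w': "(w has_vector_derivative (f u (y u) - f u (x u))) (at u within {s..t})"
      if u: "u \<in> {s..t} - N" for u
    proof -
      have u': "u \<in> {0..T} - N" using u sub by auto
      then obtain v where v: "(x has_vector_derivative v) (at u within {0..T})" "GDERIV (Ham F (x u)) (p u) :> v"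
        using system by blast
      have "v = G (x u) (p u)" using G_unique[OF p0 x_ball v(2)] u' by simp
      also have "\<dots> = f u (x u)" using cl_id[of "x u"] R(2)[of u] u' by (simp add: f_def)
      finally show ?thesis
        unfolding w_def using u has_vector_derivative_within_subset[OF v(1) sub]
        by (auto intro!: has_vector_derivative_diff y')
    qed
    define d where "d = norm (z - x t)"
    have w_bound: "norm (w u) \<le> 2 * d" if "u \<in> {s..t}" for u
    proof -
      have "norm (w u) \<le> 2 * norm (w t)"
      proof (rule short_time_backward_bound[OF w_ac N _ L\<^sub>G_nonneg st(4) that])
        fix v assume v: "v \<in> {s..t} - N"
        have "norm (f v (y v) - f v (x v)) \<le> L\<^sub>G * norm (cl (y v) - cl (x v))"
          unfolding f_def using v sub p0 cl by (intro lipschitz_on_normD[OF G_lip]) auto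
        also have "\<dots> \<le> L\<^sub>G * norm (w v)" unfolding w_def by (intro mult_left_mono cl_lip L\<^sub>G_nonneg)
        finally show "\<exists>v'. (w has_vector_derivative v') (at v within {s..t}) \<and> norm v' \<le> L\<^sub>G * norm (w v)"
          using w'[OF v] by blast
      qed
      then show ?thesis by (simp add: w_def yt d_def)
    qed
    \<comment> \<open>Hence the projection is inactive along \<open>y\<close>, which is therefore a
      genuine trajectory of \<open>F\<close>.\<close>
    have y_R: "norm (y u) \<le> R" if "u \<in> {s..t}" for u
    proof -
      have "norm (y u) \<le> norm (x u) + norm (w u)" unfolding w_def by norm
      then show ?thesis using w_bound[OF that] z R(2)[of u] that sub by (auto simp: d_def)
    qed
    have f_y: "f u (y u) = G (y u) (p u)" if "u \<in> {s..t}" for u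
      using cl_id[OF y_R[OF that]] by (simp add: f_def)
    have tr: "trajectory F (t - s) (y s) (\<lambda>u. y (s + u))"
      unfolding trajectory_iff
    proof (intro conjI exI[of _ "{}"] ballI)
      have "B-lipschitz_on {0..t - s} (\<lambda>u. y (s + u))"
      proof (rule lipschitz_onI)
        show "dist (y (s + u)) (y (s + v)) \<le> B * dist u v" if "u \<in> {0..t - s}" "v \<in> {0..t - s}" for u v
          using lipschitz_onD[OF y_lip, of "s + u" "s + v"] that by (auto simp: dist_real_def)
      qed (rule B(1))
      then show "abs_continuous_on {0..t - s} (\<lambda>u. y (s + u))" by (rule lipschitz_on_imp_abs_continuous_on)
      fix u assume "u \<in> {0..t - s} - {}"
      then have u: "s + u \<in> {s..t}" by auto
      have "((\<lambda>u. y (s + u)) has_vector_derivative f (s + u) (y (s + u))) (at u within {0..t - s})"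
        by (rule has_vector_derivative_shift[OF y'[OF u]]) auto
      then show "\<exists>v\<in>F (y (s + u)). ((\<lambda>u. y (s + u)) has_vector_derivative v) (at u within {0..t - s})"
        using f_F[OF u, of "y (s + u)"] cl_id[OF y_R[OF u]] by auto
    qed auto
    have "min_time F K (y s) \<le> ereal (t - s) + min_time F K z"
      using min_time_trajectory_le[OF F tr, of K] st yt by simp
    also have "\<dots> \<le> ereal (t - s) + ereal \<beta>" using \<beta> by (rule add_left_mono)
    \<comment> \<open>So \<open>(y s, t - s + \<beta>)\<close> lies in the epigraph, and its
      increment over \<open>T - s\<close> is again \<open>\<beta> - (T - t)\<close>.\<close>
    finally have "min_time F K (y s) \<le> ereal (t - s + \<beta>)" by simp
    from prox_s[OF this]
    have at_s: "- p s \<bullet> w s - (\<beta> - (T - t)) \<le> \<sigma> * ((norm (w s))\<^sup>2 + (\<beta> - (T - t))\<^sup>2)"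
      by (simp add: w_def algebra_simps)
    have "- (C * d\<^sup>2) * (t - s) \<le> p t \<bullet> w t - p s \<bullet> w s"
    proof (rule abs_continuous_on_derivative_ge[OF abs_continuous_on_inner[OF abs_continuous_on_subset[OF p sub] w_ac] N _ st(2)])
      fix u assume u: "u \<in> {s..t} - N"
      then have u': "u \<in> {0..T} - N" and us: "u \<in> {s..t}" using sub by auto
      obtain q where q: "(p has_vector_derivative q) (at u within {0..T})"
        "- q \<in> clarke_gradient (\<lambda>y. Ham F y (p u)) (x u)" using system[OF u'] by blast
      have y_ball: "y u \<in> ball 0 r" using y_R[OF us] R(1) by simp
      have x_ball': "x u \<in> ball 0 r" and pu: "p u \<noteq> 0" using x_ball p0 u' by auto
      have "((\<lambda>u. p u \<bullet> w u) has_vector_derivative (p u \<bullet> (f u (y u) - f u (x u)) + q \<bullet> w u)) (at u within {s..t})"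
        by (rule bounded_bilinear.has_vector_derivative[OF bounded_bilinear_inner
              has_vector_derivative_within_subset[OF q(1) sub] w'[OF u]])
      \<comment> \<open>The first term is a difference of Hamiltonians. By the Clarke inequality it
        is at least \<open>- q \<bullet> w u\<close> up to a quadratic error, which cancels the
        second term.\<close>
      moreover have "- (C * d\<^sup>2) \<le> p u \<bullet> (f u (y u) - f u (x u)) + q \<bullet> w u"
      proof -
        have "f u (y u) \<bullet> p u = Ham F (y u) (p u)"
          using Ham_gradient(2)[OF F G[OF pu y_ball]] f_y[OF us] by simp
        moreover have "f u (x u) \<bullet> p u = Ham F (x u) (p u)"
          using Ham_gradient(2)[OF F G[OF pu x_ball']] cl_id[of "x u"] R(2)[of u] u' by (simp add: f_def)
        moreover have "Ham F (x u) (p u) + (- q) \<bullet> w u - c * norm (p u) / 2 * (norm (w u))\<^sup>2 \<le> Ham F (y u) (p u)"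
          unfolding w_def by (rule Ham_clarke_ineq[OF F semiconvex x_ball' y_ball q(2) pu])
        moreover have "c * norm (p u) / 2 * (norm (w u))\<^sup>2 \<le> c * P / 2 * (2 * d)\<^sup>2"
          using P(2)[of u] u' c P(1) w_bound[OF us] by (intro mult_mono divide_right_mono mult_left_mono power_mono) auto
        moreover have "c * P / 2 * (2 * d)\<^sup>2 = C * d\<^sup>2" by (simp add: C_def power_mult_distrib)
        moreover have "p u \<bullet> (f u (y u) - f u (x u)) = f u (y u) \<bullet> p u - f u (x u) \<bullet> p u"
          by (simp add: inner_diff_right inner_commute)
        moreover have "(- q) \<bullet> w u = - (q \<bullet> w u)" by simp
        ultimately show ?thesis by linarith
      qed
      ultimately show "\<exists>v. ((\<lambda>u. p u \<bullet> w u) has_vector_derivative v) (at u within {s..t}) \<and> - (C * d\<^sup>2) \<le> v"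
        by blast
    qed
    moreover have "C * d\<^sup>2 * (t - s) \<le> C * d\<^sup>2 * T" using C0 st by (intro mult_left_mono) auto
    moreover have "\<sigma> * (norm (w s))\<^sup>2 \<le> \<sigma> * (2 * d)\<^sup>2"
      using w_bound[of s] st \<sigma> by (intro mult_left_mono power_mono) auto
    \<comment> \<open>This raises the coefficient of the squared value increment from
      \<open>\<sigma>\<close> to \<open>4 * \<sigma> + C * T\<close>.\<close>
    moreover have "0 \<le> (3 * \<sigma> + C * T) * (\<beta> - (T - t))\<^sup>2" using \<sigma> C0 T_nonneg by simp
    ultimately show "- p t \<bullet> (z - x t) - (\<beta> - (T - t)) \<le> (4 * \<sigma> + C * T) * ((norm (z - x t))\<^sup>2 + (\<beta> - (T - t))\<^sup>2)"
      using at_s unfolding d_def[symmetric] w_def[of t] yt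
      by (simp add: algebra_simps)
  qed simp
qed

text \<open>The test points are \<open>(x u, T - u)\<close>, which lie on the graph of the minimum
  time.\<close>

lemma proximal_along_x:
  assumes prox: "- p t \<in> proximal_subdifferential (min_time F K) (x t)" and t: "t \<in> {0..T}"
  obtains \<sigma> where "0 \<le> \<sigma>" "\<And>u. u \<in> {0..T} \<Longrightarrow>
      - p t \<bullet> (x u - x t) + (u - t) \<le> \<sigma> * ((norm (x u - x t))\<^sup>2 + (u - t)\<^sup>2)"
proof -
  obtain \<sigma> where \<sigma>: "0 \<le> \<sigma>" and le: "\<And>y \<beta>. min_time F K y \<le> ereal \<beta> \<Longrightarrow>
      - p t \<bullet> (y - x t) - (\<beta> - (T - t)) \<le> \<sigma> * ((norm (y - x t))\<^sup>2 + (\<beta> - (T - t))\<^sup>2)"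
    using prox proximal_subdifferential_iff[of "min_time F K" "x t" "T - t"] min_time_x[OF t] by auto
  have "- p t \<bullet> (x u - x t) + (u - t) \<le> \<sigma> * ((norm (x u - x t))\<^sup>2 + (u - t)\<^sup>2)" if "u \<in> {0..T}" for u
    using le[of "x u" "T - u"] min_time_x[OF that] by (simp add: power2_commute)
  then show ?thesis using that \<sigma> by blast
qed

text \<open>With a zero covector the inequality along the Lipschitz arc would bound \<open>u\<close>
  by a multiple of its square for all small positive \<open>u\<close>.\<close>

lemma p_initial_nonzero:
  assumes prox: "- p 0 \<in> proximal_subdifferential (min_time F K) (x 0)" and T_pos: "0 < T"
  shows "p 0 \<noteq> 0"
proof
  assume p0: "p 0 = 0"
  obtain \<sigma> where \<sigma>: "0 \<le> \<sigma>" "\<And>u. u \<in> {0..T} \<Longrightarrow>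
      - p 0 \<bullet> (x u - x 0) + (u - 0) \<le> \<sigma> * ((norm (x u - x 0))\<^sup>2 + (u - 0)\<^sup>2)"
    using proximal_along_x[OF prox] T_pos by auto
  obtain M where M: "M-lipschitz_on {0..T} x" using trajectory_lipschitz[OF F x] .
  define C where "C = \<sigma> * (M\<^sup>2 + 1) + 1"
  have C: "1 \<le> C" using \<sigma>(1) by (simp add: C_def)
  \<comment> \<open>The second bound makes \<open>C * u\<close> at most \<open>1 / 2\<close>,
    against the derived \<open>1 \<le> C * u\<close>; the first keeps \<open>u\<close> in the time
    interval.\<close>
  define u where "u = min T (1 / (2 * C))"
  have u: "0 < u" "u \<le> T" "u \<le> 1 / (2 * C)" using C T_pos by (auto simp: u_def)
  have "norm (x u - x 0) \<le> M * u" using lipschitz_on_normD[OF M, of u 0] u by simp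
  then have "(norm (x u - x 0))\<^sup>2 \<le> (M * u)\<^sup>2" by (intro power_mono) auto
  then have "\<sigma> * ((norm (x u - x 0))\<^sup>2 + u\<^sup>2) \<le> \<sigma> * ((M * u)\<^sup>2 + u\<^sup>2)"
    using \<sigma>(1) by (intro mult_left_mono) auto
  then have "u \<le> \<sigma> * ((M * u)\<^sup>2 + u\<^sup>2)" using \<sigma>(2)[of u] u p0 by simp
  also have "\<dots> = (\<sigma> * (M\<^sup>2 + 1)) * u * u" by (simp add: power2_eq_square algebra_simps)
  also have "\<dots> \<le> C * u * u" using u(1) by (intro mult_right_mono) (auto simp: C_def)
  finally have "1 \<le> C * u" using u(1) by simp
  also have "\<dots> \<le> C * (1 / (2 * C))" using u(3) C by (intro mult_left_mono) auto
  also have "\<dots> < 1" using C by simp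
  finally show False by simp
qed

text \<open>The velocity agrees almost everywhere with a continuous function whose integral recovers
  \<open>x\<close>, so the derivative exists at every time, as a pointwise test at a given
  \<open>t\<close> needs.\<close>

lemma x_has_vector_derivative:
  assumes p0: "\<And>u. u \<in> {0..T} \<Longrightarrow> p u \<noteq> 0" and t: "t \<in> {0..T}"
  shows "(x has_vector_derivative G (x t) (p t)) (at t within {0..T})"
proof -
  let ?g = "\<lambda>u. G (x u) (p u)"
  have g: "continuous_on {0..T} ?g"
    by (rule continuous_on_G[OF x_continuous p_continuous x_ball p0])
  have x_eq: "x u = x 0 + integral {0..u} ?g" if u: "u \<in> {0..T}" for u
  proof -
    have sub: "{0..u} \<subseteq> {0..T}" using u by auto
    have "(?g has_integral (x u - x 0)) {0..u}"
    proof (rule has_integral_abs_continuous_on[OF _ _ N])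
      show "abs_continuous_on {0..u} x"
        using x abs_continuous_on_subset[OF _ sub] by (auto simp: trajectory_iff)
      fix v assume "v \<in> {0..u} - N"
      then have v: "v \<in> {0..T} - N" using sub by auto
      then obtain v' where v': "(x has_vector_derivative v') (at v within {0..T})" "GDERIV (Ham F (x v)) (p v) :> v'"
        using system by blast
      then have "v' = ?g v" using G_unique[OF p0 x_ball] v by blast
      then show "(x has_vector_derivative ?g v) (at v within {0..u})"
        using has_vector_derivative_within_subset[OF v'(1) sub] by simp
    qed (use u in auto)
    then show ?thesis by (simp add: integral_unique)
  qed
  have "((\<lambda>u. x 0 + integral {0..u} ?g) has_vector_derivative (0 + ?g t)) (at t within {0..T})"
    by (intro has_vector_derivative_add has_vector_derivative_const integral_has_vector_derivative[OF g t])
  then have der: "((\<lambda>u. x 0 + integral {0..u} ?g) has_vector_derivative ?g t) (at t within {0..T})" by simp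
  show ?thesis by (rule has_vector_derivative_transform[OF t x_eq der])
qed

text \<open>The proximal inequality along the optimal trajectory, which holds on both sides of \<open>t\<close>, makes the derivative
  at \<open>t\<close> of \<open>u - p t \<bullet> x u\<close> vanish.\<close>

lemma Ham_eq_1_interior:
  assumes p0: "\<And>u. u \<in> {0..T} \<Longrightarrow> p u \<noteq> 0" and t: "0 < t" "t < T"
    and prox: "- p t \<in> proximal_subdifferential (min_time F K) (x t)"
  shows "G (x t) (p t) \<bullet> p t = 1"
proof -
  let ?v = "G (x t) (p t)"
  obtain \<sigma> where \<sigma>: "\<And>u. u \<in> {0..T} \<Longrightarrow>
      - p t \<bullet> (x u - x t) + (u - t) \<le> \<sigma> * ((norm (x u - x t))\<^sup>2 + (u - t)\<^sup>2)"
    using proximal_along_x[OF prox] t by auto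
  \<comment> \<open>Squared norms appear as inner products to ease differentiation.
    \<open>\<psi>\<close> vanishes at \<open>t\<close> and is nonpositive on the interval, and its
    quadratic part has zero derivative at \<open>t\<close>.\<close>
  define \<psi> where "\<psi> u = - p t \<bullet> (x u - x t) + (u - t) - \<sigma> * ((x u - x t) \<bullet> (x u - x t) + (u - t) * (u - t))" for u
  have "at t within {0..T} = at t" using t by (intro at_within_interior) auto
  then have "(x has_derivative (\<lambda>h. h *\<^sub>R ?v)) (at t)"
    using x_has_vector_derivative[OF p0, of t] t by (simp add: has_vector_derivative_def)
  then have "(\<psi> has_derivative (\<lambda>h. h * (1 - p t \<bullet> ?v))) (at t)"
    unfolding \<psi>_def by (auto intro!: derivative_eq_intros simp: algebra_simps)
  then have der: "(\<psi> has_field_derivative (1 - p t \<bullet> ?v)) (at t)"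
    by (simp add: has_field_derivative_def mult_commute_abs)
  have "1 - p t \<bullet> ?v = 0"
  proof (rule DERIV_local_max[OF der, of "min t (T - t)"])
    show "\<forall>u. \<bar>t - u\<bar> < min t (T - t) \<longrightarrow> \<psi> u \<le> \<psi> t"
    proof (intro allI impI)
      fix u assume "\<bar>t - u\<bar> < min t (T - t)"
      then have "u \<in> {0..T}" by (auto simp: abs_less_iff)
      then show "\<psi> u \<le> \<psi> t"
        using \<sigma>[of u] unfolding power2_norm_eq_inner power2_eq_square[of "u - t"] by (simp add: \<psi>_def)
    qed
  qed (use t in auto)
  then show ?thesis by (simp add: inner_commute)
qed

text \<open>The endpoints allow only one-sided tests, so the value of the Hamiltonian there comes
  from continuity of \<open>G (x u) (p u) \<bullet> p u\<close>.\<close>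

lemma proximal_transport:
  assumes prox: "- p 0 \<in> proximal_subdifferential (min_time F K) (x 0)" and T_pos: "0 < T" and t: "t \<in> {0..T}"
  shows "- p t \<in> proximal_subdifferential (min_time F K) (x t)" and "Ham F (x t) (p t) = 1"
proof -
  have p0: "p u \<noteq> 0" if "u \<in> {0..T}" for u
    using p_nonzero[OF p_initial_nonzero[OF prox T_pos] that] .
  have prox_all: "- p u \<in> proximal_subdifferential (min_time F K) (x u)" if u: "u \<in> {0..T}" for u
  proof (rule interval_step_induct[where P = "\<lambda>t. - p t \<in> proximal_subdifferential (min_time F K) (x t)"
        and T = T and \<delta> = "1 / (2 * (L\<^sub>G + 1))"])
    show "- p v \<in> proximal_subdifferential (min_time F K) (x v)"
      if sv: "0 \<le> s" "s \<le> v" "v \<le> T" "v - s \<le> 1 / (2 * (L\<^sub>G + 1))"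
        and "- p s \<in> proximal_subdifferential (min_time F K) (x s)" for s v
    proof (rule proximal_step[OF sv(1-3) _ p0])
      have "L\<^sub>G * (v - s) \<le> L\<^sub>G * (1 / (2 * (L\<^sub>G + 1)))" using sv L\<^sub>G_nonneg by (intro mult_left_mono) auto
      also have "\<dots> \<le> 1 / 2" using L\<^sub>G_nonneg by (simp add: field_simps)
      finally show "L\<^sub>G * (v - s) \<le> 1 / 2" .
    qed (use that in auto)
  qed (use prox u L\<^sub>G_nonneg in auto)
  show "- p t \<in> proximal_subdifferential (min_time F K) (x t)" using prox_all t .
  have closure: "closure {0<..<T} = {0..T}" using T_pos by simp
  have "continuous_on {0..T} (\<lambda>u. G (x u) (p u) \<bullet> p u)"
    by (intro continuous_on_inner continuous_on_G x_continuous p_continuous x_ball p0)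
  then have "continuous_on (closure {0<..<T}) (\<lambda>u. G (x u) (p u) \<bullet> p u)"
    unfolding closure .
  then have "G (x t) (p t) \<bullet> p t = 1"
  proof (rule continuous_constant_on_closure)
    show "G (x u) (p u) \<bullet> p u = 1" if "u \<in> {0<..<T}" for u
      using that by (intro Ham_eq_1_interior[OF p0 _ _ prox_all]) auto
  qed (use t closure in simp)
  then show "Ham F (x t) (p t) = 1"
    using Ham_gradient(2)[OF F G[OF p0[OF t] x_ball[OF t]]] by simp
qed

end

section \<open>Choice of the ball and its constants, and passage from \<open>Ham\<close> to
  \<open>min_Ham\<close>\<close>

theorem corollary4p7:
  fixes F :: "real ^ 'n \<Rightarrow> (real ^ 'n) set"
    and K :: "(real ^ 'n) set"
    and x0 :: "real ^ 'n"
    and x p :: "real \<Rightarrow> real ^ 'n"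
  assumes "assumption_F F"
    and "assumption_H F"
    and "closed K"
    and "x0 \<in> controllable_set F K - K"
    and "optimal_trajectory F K x0 x"
    and "abs_continuous_on {0..real_of_ereal (min_time F K x0)} p"
    and "hamiltonian_solution F (real_of_ereal (min_time F K x0)) x p"
    and "x 0 = x0"
    and "- p 0 \<in> proximal_subdifferential (min_time F K) x0"
  shows "\<forall>t \<in> {0..real_of_ereal (min_time F K x0)}.
           - p t \<in> proximal_subdifferential (min_time F K) (x t) \<and>
           min_Ham F (x t) (- p t) = - 1"
proof -
  define T where "T = real_of_ereal (min_time F K x0)"
  have T: "min_time F K x0 = ereal T"
    using assms(4) min_time_nonneg[of F K x0]
    by (cases "min_time F K x0") (auto simp: T_def controllable_set_def)
  have x: "trajectory F T x0 x" and xT: "x T \<in> K"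
    using assms(5) by (auto simp: optimal_trajectory_def T_def Let_def)
  \<comment> \<open>A zero optimal time would put \<open>x0 = x 0\<close> in the target.\<close>
  have "T \<noteq> 0" using xT assms(4,8) by auto
  moreover have "0 \<le> T" using min_time_nonneg[of F K x0] T by simp
  ultimately have T_pos: "0 < T" by simp
  obtain N where N: "negligible N" and system: "\<And>s. s \<in> {0..T} - N \<Longrightarrow>
        (\<exists>v w. (x has_vector_derivative v) (at s within {0..T}) \<and>
               (p has_vector_derivative w) (at s within {0..T}) \<and>
               GDERIV (Ham F (x s)) (p s) :> v \<and>
               - w \<in> clarke_gradient (\<lambda>y. Ham F y (p s)) (x s))"
    using assms(7) unfolding hamiltonian_solution_def T_def[symmetric] AE_lebesgue_iff_negligible by blast
  have "bounded (x ` {0..T})"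
    using x by (auto simp: trajectory_iff
        intro!: compact_imp_bounded compact_continuous_image abs_continuous_on_imp_continuous_on)
  then obtain B where B: "B > 0" "\<And>s. s \<in> {0..T} \<Longrightarrow> norm (x s) \<le> B"
    unfolding bounded_pos by auto
  \<comment> \<open>Adding two leaves strict room for the margin of one.\<close>
  define r where "r = B + 2"
  have "0 < r" using B(1) by (simp add: r_def)
  then have H: "(\<exists>c\<ge>0. \<forall>p\<in>sphere 0 1. semiconvex_on c (ball 0 r) (\<lambda>x. Ham F x p)) \<and>
     (\<exists>L G. \<forall>p. p \<noteq> 0 \<longrightarrow> (\<forall>x\<in>ball 0 r. GDERIV (Ham F x) p :> G x p) \<and> L-lipschitz_on (ball 0 r) (\<lambda>x. G x p))"
    using assms(2) unfolding assumption_H_def by (elim allE[of _ r] mp)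
  obtain c where c: "0 \<le> c" "\<forall>p\<in>sphere 0 1. semiconvex_on c (ball 0 r) (\<lambda>x. Ham F x p)"
    using H[THEN conjunct1] by (elim exE conjE)
  obtain L\<^sub>G G where G: "\<And>p. p \<noteq> 0 \<Longrightarrow> (\<forall>x\<in>ball 0 r. GDERIV (Ham F x) p :> G x p) \<and> L\<^sub>G-lipschitz_on (ball 0 r) (\<lambda>x. G x p)"
    using H[THEN conjunct2] by (elim exE) blast
  \<comment> \<open>Since (F2) concerns compact sets, the estimate is taken on the closed ball and
    then restricted to the open one.\<close>
  obtain L\<^sub>p where L\<^sub>p: "L\<^sub>p > 0"
    "\<And>x y p. \<lbrakk>x \<in> cball 0 r; y \<in> cball 0 r\<rbrakk> \<Longrightarrow> \<bar>Ham F x p - Ham F y p\<bar> \<le> L\<^sub>p * norm p * norm (x - y)"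
    using Ham_lipschitz[OF assms(1) compact_cball] by blast
  interpret dual_arc F K x0 x p T N r c L\<^sub>G L\<^sub>p G
  proof
    show "norm (x s) + 1 < r" if "s \<in> {0..T}" for s using B(2)[OF that] by (simp add: r_def)
    show "abs_continuous_on {0..T} p" using assms(6) by (simp add: T_def)
    show "GDERIV (Ham F y) q :> G y q" if "q \<noteq> 0" "y \<in> ball 0 r" for q y
      using G[OF that(1)] that(2) by blast
    show "L\<^sub>G-lipschitz_on (ball 0 r) (\<lambda>y. G y q)" if "q \<noteq> 0" for q
      using G[OF that] by blast
    show "\<bar>Ham F y q - Ham F z q\<bar> \<le> L\<^sub>p * norm q * norm (y - z)" if "y \<in> ball 0 r" "z \<in> ball 0 r" for y z q
      using that by (intro L\<^sub>p(2)) auto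
    show "0 \<le> L\<^sub>p" using L\<^sub>p(1) by simp
  qed (fact assms(1) x T xT N system c)+
  have "- p 0 \<in> proximal_subdifferential (min_time F K) (x 0)" using assms(8,9) by simp
  then show ?thesis
    using proximal_transport[OF _ T_pos] min_Ham_uminus[OF assms(1)] unfolding T_def[symmetric] by simp
qed

end
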